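(* Let $d\ge 3$ be odd and let $n\ge 2$. With respect to the extended $S_{n+1}$-action on $H^*(C_n(d);\mathbb{C})$ there is an isomorphism of $S_{n+1}$-modules $$H^{d-1}(C_n(d);\mathbb{C})\;\cong\;\textstyle\bigwedge^2 V_{(n,1)}\;\cong\; V_{(n-1,1,1)},$$ and, with respect to the natural $S_n$-action, there is an isomorphism of $S_n$-modules $$H^{d-1}(C_n(d);\mathbb{C})\;\cong\; V_{(n-1,1)}\oplus V_{(n-2,1,1)},$$ where for $n=2$ the term $V_{(n-2,1,1)}$ is understood to be $0$.
   Context: For $d\ge 2$, $C_n(d)=\{(p_1,\dots,p_n)\in(\mathbb{R}^d)^n : p_i\ne p_j \text{ for } i\neq j\}$ is the configuration space of $n$ points in $\mathbb{R}^d$; $S_n$ acts on it by permuting coordinates, hence on $H^*(C_n(d);\mathbb{C})$ (the natural action). The algebra $H^*(C_n(d);\mathbb{C})$ is presented as the associative graded algebra with generators $A_{i,j}$, $1\le i,j\le n$ (with $A_{i,i}=0$), of degree $d-1$ and relations $A_{i,j}=(-1)^dA_{j,i}$, $A_{i,j}A_{h,k}=(-1)^{d-1}A_{h,k}A_{i,j}$, $A_{i,j}A_{i,k}=A_{k,j}(A_{i,k}-A_{i,j})$ for $1\le i\le n$, $j\le k$; the natural action of $\sigma\in S_n$ is $\sigma A_{i,j}=A_{\sigma i,\sigma j}$. Extended action for $d$ odd: regard $S_{n+1}$ as the permutation group of $\{0,1,\dots,n\}$ and $S_n$ as the stabilizer of $0$. $S_{n+1}$ acts on $H^*(C_n(d);\mathbb{C})$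 by graded algebra automorphisms, extending the natural $S_n$-action, with the transposition $(0,1)$ acting by $(0,1)A_{i,j}=A_{i,j}-A_{1,j}+A_{1,i}$ for $1<i<j$ and $(0,1)A_{1,j}=-A_{1,j}$. For a partition $\lambda$ of $m$, $V_\lambda$ denotes the irreducible complex representation of $S_m$ indexed by $\lambda$, with $V_{(m)}$ the trivial representation and $V_{(m-1,1)}$ the standard representation (the sum-zero subspace of the permutation representation $\mathbb{C}^m$). *)

theory Defs
  imports
    Complex_Main
    "HOL-Library.Poly_Mapping"
    "HOL-Combinatorics.Permutations"
    "HOL-Algebra.Module"
    "HOL-Algebra.QuotRing"
    "HOL-Algebra.Sym_Groups"
begin

section \<open>Free complex vector spaces\<close>

text \<open>\<^typ>\<open>'a \<Rightarrow>\<^sub>0 complex\<close> is the complex vector space with basis \<^typ>\<open>'a\<close>.\<close>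

definition pm_scale :: "complex \<Rightarrow> ('a \<Rightarrow>\<^sub>0 complex) \<Rightarrow> ('a \<Rightarrow>\<^sub>0 complex)"
  where "pm_scale c p = Poly_Mapping.map ((*) c) p"

lemma lookup_pm_scale [simp]: "Poly_Mapping.lookup (pm_scale c p) k = c * Poly_Mapping.lookup p k"
  by (simp add: pm_scale_def Poly_Mapping.map.rep_eq when_def)

global_interpretation pm: vector_space pm_scale
  by unfold_locales (auto intro!: poly_mapping_eqI simp: lookup_add algebra_simps)

text \<open>The linear map induced by a map of bases.\<close>

definition pm_push :: "('a \<Rightarrow> 'b) \<Rightarrow> ('a \<Rightarrow>\<^sub>0 complex) \<Rightarrow> ('b \<Rightarrow>\<^sub>0 complex)"
  where "pm_push f p = (\<Sum>k\<in>Poly_Mapping.keys p. Poly_Mapping.single (f k) (Poly_Mapping.lookup p k))"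


section \<open>Representations over the complex numbers\<close>

definition complex_field :: "complex ring"
  where "complex_field = \<lparr>carrier = UNIV, monoid.mult = (*), one = 1, zero = 0, add = (+)\<rparr>"

text \<open>The fields \<^const>\<open>mult\<close> and \<^const>\<open>one\<close> of a record used only as a vector space are irrelevant.\<close>

record ('g, 'v) rep = "(complex, 'v) module" +
  act :: "'g \<Rightarrow> 'v \<Rightarrow> 'v"

definition free_module :: "'a set \<Rightarrow> (complex, 'a \<Rightarrow>\<^sub>0 complex) module"
  where "free_module S = \<lparr>carrier = {p. Poly_Mapping.keys p \<subseteq> S}, monoid.mult = undefined, one = undefined,
    zero = 0, add = (+), smult = pm_scale\<rparr>"

text \<open>The map on cosets of \<open>N\<close> induced by a map \<open>f\<close> that sends cosets into cosets.\<close>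

definition quot_map :: "('b, 'm) ring_scheme \<Rightarrow> 'b set \<Rightarrow> ('b \<Rightarrow> 'b) \<Rightarrow> 'b set \<Rightarrow> 'b set"
  where "quot_map M N f X = (\<Union>x\<in>X. N +>\<^bsub>M\<^esub> f x)"

definition quot_module :: "('a, 'b, 'm) module_scheme \<Rightarrow> 'b set \<Rightarrow> ('a, 'b set) module"
  where "quot_module M N = \<lparr>carrier = a_rcosets\<^bsub>M\<^esub> N, monoid.mult = undefined, one = undefined,
    zero = N, add = set_add M, smult = (\<lambda>c. quot_map M N (smult M c))\<rparr>"

locale representation = group G + V: Module.module complex_field V
  for G :: "('g, 'm) monoid_scheme" and V :: "('g, 'v) rep" +
  assumes act_closed: "\<lbrakk>g \<in> carrier G; v \<in> carrier V\<rbrakk> \<Longrightarrow> act V g v \<in> carrier V"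
    and act_add: "\<lbrakk>g \<in> carrier G; v \<in> carrier V; w \<in> carrier V\<rbrakk>
      \<Longrightarrow> act V g (v \<oplus>\<^bsub>V\<^esub> w) = act V g v \<oplus>\<^bsub>V\<^esub> act V g w"
    and act_smult: "\<lbrakk>g \<in> carrier G; v \<in> carrier V\<rbrakk>
      \<Longrightarrow> act V g (c \<odot>\<^bsub>V\<^esub> v) = c \<odot>\<^bsub>V\<^esub> act V g v"
    and act_one: "v \<in> carrier V \<Longrightarrow> act V \<one>\<^bsub>G\<^esub> v = v"
    and act_mult: "\<lbrakk>g \<in> carrier G; h \<in> carrier G; v \<in> carrier V\<rbrakk>
      \<Longrightarrow> act V (g \<otimes>\<^bsub>G\<^esub> h) v = act V g (act V h v)"

definition rep_hom :: "('g, 'm) monoid_scheme \<Rightarrow> ('g, 'v) rep \<Rightarrow> ('g, 'w) rep \<Rightarrow> ('v \<Rightarrow> 'w) set"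
  where "rep_hom G V W = {f \<in> carrier V \<rightarrow> carrier W.
    (\<forall>v\<in>carrier V. \<forall>w\<in>carrier V. f (v \<oplus>\<^bsub>V\<^esub> w) = f v \<oplus>\<^bsub>W\<^esub> f w) \<and>
    (\<forall>c. \<forall>v\<in>carrier V. f (c \<odot>\<^bsub>V\<^esub> v) = c \<odot>\<^bsub>W\<^esub> f v) \<and>
    (\<forall>g\<in>carrier G. \<forall>v\<in>carrier V. f (act V g v) = act W g (f v))}"

definition rep_isomorphic :: "('g, 'm) monoid_scheme \<Rightarrow> ('g, 'v) rep \<Rightarrow> ('g, 'w) rep \<Rightarrow> bool"
  where "rep_isomorphic G V W \<longleftrightarrow> representation G V \<and> representation G W \<and>
    (\<exists>f\<in>rep_hom G V W. bij_betw f (carrier V) (carrier W))"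

definition zero_rep :: "('g, 'v::comm_monoid_add) rep"
  where "zero_rep = \<lparr>carrier = {0}, monoid.mult = undefined, one = undefined, zero = 0, add = (+),
    smult = (\<lambda>_ v. v), act = (\<lambda>_ v. v)\<rparr>"

definition direct_sum_rep :: "('g, 'v) rep \<Rightarrow> ('g, 'w) rep \<Rightarrow> ('g, 'v \<times> 'w) rep"
  where "direct_sum_rep V W = \<lparr>carrier = carrier V \<times> carrier W, monoid.mult = undefined, one = undefined,
    zero = (\<zero>\<^bsub>V\<^esub>, \<zero>\<^bsub>W\<^esub>),
    add = (\<lambda>(v, w) (v', w'). (v \<oplus>\<^bsub>V\<^esub> v', w \<oplus>\<^bsub>W\<^esub> w')),
    smult = (\<lambda>c (v, w). (c \<odot>\<^bsub>V\<^esub> v, c \<odot>\<^bsub>W\<^esub> w)),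
    act = (\<lambda>g (v, w). (act V g v, act W g w))\<rparr>"

text \<open>
  The exterior square of \<open>V\<close> is the free vector space on the symbols \<open>(v, w)\<close> with
  \<open>v, w \<in> V\<close>, modulo bilinearity and \<open>(v, v) = 0\<close>, with the diagonal action.
\<close>

definition ext_square_relations :: "('g, 'v) rep \<Rightarrow> ('v \<times> 'v \<Rightarrow>\<^sub>0 complex) set"
  where "ext_square_relations V = (let e = (\<lambda>v w. Poly_Mapping.single (v, w) 1) in
    {e (u \<oplus>\<^bsub>V\<^esub> v) w - e u w - e v w | u v w. u \<in> carrier V \<and> v \<in> carrier V \<and> w \<in> carrier V} \<union>
    {e u (v \<oplus>\<^bsub>V\<^esub> w) - e u v - e u w | u v w. u \<in> carrier V \<and> v \<in> carrier V \<and> w \<in> carrier V} \<union>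
    {e (c \<odot>\<^bsub>V\<^esub> v) w - pm_scale c (e v w) | c v w. v \<in> carrier V \<and> w \<in> carrier V} \<union>
    {e v (c \<odot>\<^bsub>V\<^esub> w) - pm_scale c (e v w) | c v w. v \<in> carrier V \<and> w \<in> carrier V} \<union>
    {e v v | v. v \<in> carrier V})"

definition ext_square :: "('g, 'v) rep \<Rightarrow> ('g, ('v \<times> 'v \<Rightarrow>\<^sub>0 complex) set) rep"
  where "ext_square V =
    (let F = free_module (carrier V \<times> carrier V); N = pm.span (ext_square_relations V) in
      module.extend (quot_module F N)
        (rep.fields (\<lambda>g. quot_map F N (pm_push (map_prod (act V g) (act V g))))))"


section \<open>Symmetric groups and their irreducible representations\<close>

text \<open>\<open>sym_group_on {1..n}\<close> is \<^term>\<open>sym_group n\<close>.\<close>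

definition sym_group_on :: "nat set \<Rightarrow> (nat \<Rightarrow> nat) monoid"
  where "sym_group_on X = \<lparr>carrier = {p. p permutes X}, monoid.mult = (\<circ>), one = id\<rparr>"

text \<open>
  The irreducible representation of the symmetric group on \<open>X\<close> indexed by a partition \<open>lam\<close> of
  \<open>card X\<close> (the weakly decreasing list of its positive parts) is realised as the Specht module
  spanned by the polytabloids. This is the convention in which \<open>[m]\<close> gives the trivial and
  \<open>[m - 1, 1]\<close> the standard representation. A tableau is a bijection from the cells of the
  diagram, as pairs (row, column), to \<open>X\<close>; a tabloid is the list of the rows as sets.
\<close>

definition diagram :: "nat list \<Rightarrow> (nat \<times> nat) set"
  where "diagram lam = {(i, j). i < length lam \<and> j < lam ! i}"

definition tableaux :: "nat set \<Rightarrow> nat list \<Rightarrow> (nat \<times> nat \<Rightarrow> nat) set"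
  where "tableaux X lam = {t. bij_betw t (diagram lam) X}"

definition tabloid :: "nat list \<Rightarrow> (nat \<times> nat \<Rightarrow> nat) \<Rightarrow> nat set list"
  where "tabloid lam t = map (\<lambda>i. (\<lambda>j. t (i, j)) ` {..<lam ! i}) [0..<length lam]"

definition tabloid_act :: "(nat \<Rightarrow> nat) \<Rightarrow> nat set list \<Rightarrow> nat set list"
  where "tabloid_act s T = map ((`) s) T"

definition column_stabilizer :: "nat set \<Rightarrow> nat list \<Rightarrow> (nat \<times> nat \<Rightarrow> nat) \<Rightarrow> (nat \<Rightarrow> nat) set"
  where "column_stabilizer X lam t = {s. s permutes X \<and>
    (\<forall>(i, j)\<in>diagram lam. \<exists>i'. (i', j) \<in> diagram lam \<and> s (t (i, j)) = t (i', j))}"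

definition polytabloid :: "nat set \<Rightarrow> nat list \<Rightarrow> (nat \<times> nat \<Rightarrow> nat) \<Rightarrow> (nat set list \<Rightarrow>\<^sub>0 complex)"
  where "polytabloid X lam t = (\<Sum>s\<in>column_stabilizer X lam t.
    Poly_Mapping.single (tabloid_act s (tabloid lam t)) (of_int (sign s)))"

definition specht :: "nat set \<Rightarrow> nat list \<Rightarrow> (nat \<Rightarrow> nat, nat set list \<Rightarrow>\<^sub>0 complex) rep"
  where "specht X lam = \<lparr>carrier = pm.span (polytabloid X lam ` tableaux X lam),
    monoid.mult = undefined, one = undefined, zero = 0, add = (+), smult = pm_scale,
    act = (\<lambda>s. pm_push (tabloid_act s))\<rparr>"


section \<open>The cohomology algebra of the configuration space\<close>

text \<open>
  Words form a monoid under concatenation (written additively, as \<^theory>\<open>HOL-Library.Poly_Mapping\<close>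
  requires), so that \<open>'a word \<Rightarrow>\<^sub>0 complex\<close> is the free associative unital algebra on \<^typ>\<open>'a\<close>.
\<close>

datatype 'a word = Word (letters: "'a list")

instantiation word :: (type) monoid_add
begin

definition zero_word :: "'a word" where "zero_word = Word []"

definition plus_word :: "'a word \<Rightarrow> 'a word \<Rightarrow> 'a word"
  where "plus_word v w = Word (letters v @ letters w)"

instance
  by standard (simp_all add: zero_word_def plus_word_def)

end

type_synonym free_alg = "(nat \<times> nat) word \<Rightarrow>\<^sub>0 complex"

definition gen :: "nat \<Rightarrow> nat \<Rightarrow> free_alg"
  where "gen i j = Poly_Mapping.single (Word [(i, j)]) 1"

definition free_ring :: "nat \<Rightarrow> free_alg ring"
  where "free_ring n = \<lparr>carrier = {p. \<forall>w\<in>Poly_Mapping.keys p. set (letters w) \<subseteq> {1..n} \<times> {1..n}},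
    monoid.mult = (*), one = 1, zero = 0, add = (+)\<rparr>"

definition relations :: "nat \<Rightarrow> nat \<Rightarrow> free_alg set"
  where "relations n d =
    {gen i i | i. i \<in> {1..n}} \<union>
    {gen i j - (-1) ^ d * gen j i | i j. i \<in> {1..n} \<and> j \<in> {1..n}} \<union>
    {gen i j * gen h k - (-1) ^ (d - 1) * (gen h k * gen i j) | i j h k.
      i \<in> {1..n} \<and> j \<in> {1..n} \<and> h \<in> {1..n} \<and> k \<in> {1..n}} \<union>
    {gen i j * gen i k - gen k j * (gen i k - gen i j) | i j k.
      i \<in> {1..n} \<and> j \<in> {1..n} \<and> k \<in> {1..n} \<and> j \<le> k}"

definition rel_ideal :: "nat \<Rightarrow> nat \<Rightarrow> free_alg set"
  where "rel_ideal n d = Idl\<^bsub>free_ring n\<^esub> (relations n d)"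

text \<open>
  \<open>conf_cohomology n d\<close> is the graded algebra \<open>H\<^sup>*(C\<^sub>n(d); \<complex>)\<close>, given by its standard presentation;
  \<open>conf_class n d i j\<close> is the class \<open>A\<^sub>i\<^sub>j\<close>, which has degree \<open>d - 1\<close>.
\<close>

definition conf_cohomology :: "nat \<Rightarrow> nat \<Rightarrow> (complex, free_alg set) module"
  where "conf_cohomology n d = ring.extend (free_ring n Quot rel_ideal n d)
    (module.fields (\<lambda>c. quot_map (free_ring n) (rel_ideal n d) (pm_scale c)))"

definition conf_class :: "nat \<Rightarrow> nat \<Rightarrow> nat \<Rightarrow> nat \<Rightarrow> free_alg set"
  where "conf_class n d i j = rel_ideal n d +>\<^bsub>free_ring n\<^esub> gen i j"

definition conf_cohomology_deg :: "nat \<Rightarrow> nat \<Rightarrow> nat \<Rightarrow> free_alg set set"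
  where "conf_cohomology_deg n d k = {rel_ideal n d +>\<^bsub>free_ring n\<^esub> p | p.
    p \<in> carrier (free_ring n) \<and> (\<forall>w\<in>Poly_Mapping.keys p. (d - 1) * length (letters w) = k)}"

definition natural_act :: "nat \<Rightarrow> nat \<Rightarrow> (nat \<Rightarrow> nat) \<Rightarrow> free_alg set \<Rightarrow> free_alg set"
  where "natural_act n d s =
    quot_map (free_ring n) (rel_ideal n d) (pm_push (map_word (map_prod s s)))"

definition graded_automorphism :: "nat \<Rightarrow> nat \<Rightarrow> (free_alg set \<Rightarrow> free_alg set) \<Rightarrow> bool"
  where "graded_automorphism n d f \<longleftrightarrow> (let H = conf_cohomology n d in
    f \<in> ring_iso H H \<and>
    (\<forall>c. \<forall>x\<in>carrier H. f (c \<odot>\<^bsub>H\<^esub> x) = c \<odot>\<^bsub>H\<^esub> f x) \<and>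
    (\<forall>k. f ` conf_cohomology_deg n d k = conf_cohomology_deg n d k))"

text \<open>
  For odd \<open>d\<close>, an action with these properties is unique, since \<open>(0 1)\<close> and the stabilizer of \<open>0\<close>
  generate the group and the \<open>A\<^sub>i\<^sub>j\<close> generate the algebra. Explicitly \<open>s\<close> sends \<open>A\<^sub>i\<^sub>j\<close> to
  \<open>B (s 0) (s i) (s j)\<close>, where \<open>B a b c = A\<^sub>a\<^sub>b + A\<^sub>b\<^sub>c + A\<^sub>c\<^sub>a\<close> with \<open>A\<^sub>0\<^sub>i = A\<^sub>i\<^sub>0 = 0\<close>; the relations are
  equivalent to \<open>(B a b c)\<^sup>2 = 0\<close> together with commutativity and \<open>A\<^sub>j\<^sub>i = - A\<^sub>i\<^sub>j\<close>.
\<close>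

definition extended_action :: "nat \<Rightarrow> nat \<Rightarrow> ((nat \<Rightarrow> nat) \<Rightarrow> free_alg set \<Rightarrow> free_alg set) \<Rightarrow> bool"
  where "extended_action n d \<rho> \<longleftrightarrow> (let H = conf_cohomology n d; A = conf_class n d in
    (\<forall>s. s permutes {0..n} \<longrightarrow> graded_automorphism n d (\<rho> s)) \<and>
    (\<forall>x\<in>carrier H. \<rho> id x = x) \<and>
    (\<forall>s t. s permutes {0..n} \<longrightarrow> t permutes {0..n} \<longrightarrow>
      (\<forall>x\<in>carrier H. \<rho> (s \<circ> t) x = \<rho> s (\<rho> t x))) \<and>
    (\<forall>s. s permutes {1..n} \<longrightarrow> (\<forall>x\<in>carrier H. \<rho> s x = natural_act n d s x)) \<and>
    (\<forall>i j. 1 < i \<and> i < j \<and> j \<le> n \<longrightarrow>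
      \<rho> (transpose 0 1) (A i j) = A i j \<ominus>\<^bsub>H\<^esub> A 1 j \<oplus>\<^bsub>H\<^esub> A 1 i) \<and>
    (\<forall>j. 1 < j \<and> j \<le> n \<longrightarrow> \<rho> (transpose 0 1) (A 1 j) = \<ominus>\<^bsub>H\<^esub> A 1 j))"

definition conf_cohomology_rep :: "nat \<Rightarrow> nat \<Rightarrow> nat \<Rightarrow> ((nat \<Rightarrow> nat) \<Rightarrow> free_alg set \<Rightarrow> free_alg set)
    \<Rightarrow> (nat \<Rightarrow> nat, free_alg set) rep"
  where "conf_cohomology_rep n d k \<rho> = module.extend
    ((conf_cohomology n d)\<lparr>carrier := conf_cohomology_deg n d k\<rparr>) (rep.fields \<rho>)"

end

theory Submission
  imports Defs
begin

text \<open>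
  Let \<open>e\<^sub>a\<close> be the basis of the permutation representation on a set \<open>X\<close> and put
  \<open>P(a, b, c) = e\<^sub>a \<and> e\<^sub>b + e\<^sub>b \<and> e\<^sub>c + e\<^sub>c \<and> e\<^sub>a = (e\<^sub>b - e\<^sub>a) \<and> (e\<^sub>c - e\<^sub>a)\<close>. Writing \<open>e\<^sub>x \<and> e\<^sub>y\<close> for the
  difference of the tabloids with singleton rows \<open>{x}, {y}\<close> and \<open>{y}, {x}\<close>, the polytabloids of shape
  \<open>[k, 1, 1]\<close> are exactly the \<open>P(a, b, c)\<close>, and \<open>u \<and> v\<close> identifies the exterior square of the standard
  representation with their span. In degree \<open>d - 1\<close> only the relations \<open>A\<^sub>i\<^sub>j = - A\<^sub>j\<^sub>i\<close> matter, so
  \<open>A\<^sub>i\<^sub>j \<mapsto> P(0, i, j)\<close> is an isomorphism; it commutes with \<open>(0 1)\<close> because of the cocycle identity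
  \<open>P(1, i, j) = P(0, i, j) - P(0, 1, j) + P(0, 1, i)\<close>. For the natural action,
  \<open>A\<^sub>i\<^sub>j \<mapsto> (e\<^sub>i - e\<^sub>j, \<Sum>\<^sub>k P(i, j, k))\<close> is an isomorphism onto the direct sum. In each case the inverse
  is written down explicitly, which avoids dimension counts.
\<close>

section \<open>Linear maps between free vector spaces\<close>

text \<open>Specht modules are given as spans of polytabloids, with no basis at hand on which an
  inverse could be prescribed. The inverse candidates \<open>G\<close> are therefore linear maps on
  the whole space of tabloids, where any choice of values on basis elements is legitimate. They
  invert \<open>F\<close> only modulo relations: \<open>F\<close> kills the relations and
  \<open>p - G (F p)\<close> is a combination of relations, which is checked on generators. Since
  tabloids record ordered pairs, \<open>G\<close> gives each order half of the weight; this is the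
  origin of every factor \<open>1/2\<close>. The extended action is known only through its
  properties. The images of the generators under a general permutation are never computed;
  compatibility with the isomorphism is instead shown to be stable under linear combinations, under
  change of representative modulo the ideal, and under composition of permutations. The cohomology
  is a quotient by a two-sided ideal of a noncommutative free algebra, and the ideal must be
  controlled in word length one. This is done by functionals that see only the words of length
  one.\<close>

global_interpretation pm_pair: vector_space_pair pm_scale pm_scale ..

abbreviation pm_linear :: "(('a \<Rightarrow>\<^sub>0 complex) \<Rightarrow> ('b \<Rightarrow>\<^sub>0 complex)) \<Rightarrow> bool"
  where "pm_linear \<equiv> Vector_Spaces.linear pm_scale pm_scale"

lemma pm_linearI:
  assumes "\<And>p q. f (p + q) = f p + f q" "\<And>c p. f (pm_scale c p) = pm_scale c (f p)"
  shows "pm_linear f"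
  using assms by (simp add: Vector_Spaces.linear_iff pm.vector_space_axioms)

lemmas pm_linear_add = pm_pair.linear_add
  and pm_linear_scale = pm_pair.linear_scale
  and pm_linear_0 = pm_pair.linear_0
  and pm_linear_diff = pm_pair.linear_diff
  and pm_linear_neg = pm_pair.linear_neg
  and pm_linear_sum = pm_pair.linear_sum

lemma pm_scale_single [simp]: "pm_scale c (Poly_Mapping.single k a) = Poly_Mapping.single k (c * a)"
  by (rule poly_mapping_eqI) (simp add: lookup_single when_def)

lemma pm_decompose:
  "p = (\<Sum>k\<in>Poly_Mapping.keys p. pm_scale (Poly_Mapping.lookup p k) (Poly_Mapping.single k 1))"
proof (rule poly_mapping_eqI)
  fix k
  show "Poly_Mapping.lookup p k = Poly_Mapping.lookup
    (\<Sum>k\<in>Poly_Mapping.keys p. pm_scale (Poly_Mapping.lookup p k) (Poly_Mapping.single k 1)) k"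
    by (cases "k \<in> Poly_Mapping.keys p")
      (simp_all add: lookup_sum lookup_single when_def sum.delta' in_keys_iff)
qed

lemma pm_keys_eq_span:
  "{p :: 'a \<Rightarrow>\<^sub>0 complex. Poly_Mapping.keys p \<subseteq> S} = pm.span ((\<lambda>k. Poly_Mapping.single k 1) ` S)"
proof
  show "{p :: 'a \<Rightarrow>\<^sub>0 complex. Poly_Mapping.keys p \<subseteq> S} \<subseteq> pm.span ((\<lambda>k. Poly_Mapping.single k 1) ` S)"
  proof
    fix p :: "'a \<Rightarrow>\<^sub>0 complex"
    assume "p \<in> {p. Poly_Mapping.keys p \<subseteq> S}"
    then have "(\<Sum>k\<in>Poly_Mapping.keys p. pm_scale (Poly_Mapping.lookup p k) (Poly_Mapping.single k 1))
        \<in> pm.span ((\<lambda>k. Poly_Mapping.single k 1) ` S)"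
      by (intro pm.span_sum pm.span_scale pm.span_base) auto
    then show "p \<in> pm.span ((\<lambda>k. Poly_Mapping.single k 1) ` S)"
      by (simp only: pm_decompose[of p, symmetric])
  qed
  have "pm.subspace {p :: 'a \<Rightarrow>\<^sub>0 complex. Poly_Mapping.keys p \<subseteq> S}"
    unfolding pm.subspace_def
    by (auto simp: in_keys_iff lookup_add subset_eq)
  then show "pm.span ((\<lambda>k. Poly_Mapping.single k 1) ` S) \<subseteq> {p :: 'a \<Rightarrow>\<^sub>0 complex. Poly_Mapping.keys p \<subseteq> S}"
    by (intro pm.span_minimal) auto
qed

lemma pm_linear_in_subspace:
  assumes "pm_linear f" "pm.subspace N" "\<And>x. x \<in> S \<Longrightarrow> f x \<in> N" "x \<in> pm.span S"
  shows "f x \<in> N"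
  using assms(4)
proof (induction rule: pm.span_induct_alt)
  case base
  then show ?case using assms by (simp add: pm_linear_0 pm.subspace_0)
next
  case (step c x y)
  then show ?case
    using assms by (simp add: pm_linear_add pm_linear_scale pm.subspace_add pm.subspace_scale)
qed

lemmas pm_linear_eq_on_span = pm_pair.linear_eq_on_span
lemmas pm_linear_image_span = pm_pair.linear_span_image

definition lin_ext :: "('a \<Rightarrow> ('b \<Rightarrow>\<^sub>0 complex)) \<Rightarrow> ('a \<Rightarrow>\<^sub>0 complex) \<Rightarrow> ('b \<Rightarrow>\<^sub>0 complex)"
  where "lin_ext h p = (\<Sum>k\<in>Poly_Mapping.keys p. pm_scale (Poly_Mapping.lookup p k) (h k))"

text \<open>Cancellation can make the support of \<open>p + q\<close> smaller than the union of the
  supports. A common finite index set makes the sums for \<open>p\<close>, \<open>q\<close> and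
  \<open>p + q\<close> comparable.\<close>

lemma lin_ext_superset:
  assumes "finite K" "Poly_Mapping.keys p \<subseteq> K"
  shows "lin_ext h p = (\<Sum>k\<in>K. pm_scale (Poly_Mapping.lookup p k) (h k))"
  unfolding lin_ext_def by (rule sum.mono_neutral_left) (use assms in \<open>auto simp: in_keys_iff\<close>)

lemma linear_lin_ext: "pm_linear (lin_ext h)"
proof (rule pm_linearI)
  fix p q :: "'a \<Rightarrow>\<^sub>0 complex"
  let ?K = "Poly_Mapping.keys p \<union> Poly_Mapping.keys q"
  have "lin_ext h r = (\<Sum>k\<in>?K. pm_scale (Poly_Mapping.lookup r k) (h k))"
    if "r \<in> {p, q, p + q}" for r
    using that keys_add[of p q] by (intro lin_ext_superset) auto
  then show "lin_ext h (p + q) = lin_ext h p + lin_ext h q"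
    by (simp add: lookup_add pm.scale_left_distrib sum.distrib)
next
  fix c and p :: "'a \<Rightarrow>\<^sub>0 complex"
  have "Poly_Mapping.keys (pm_scale c p) \<subseteq> Poly_Mapping.keys p"
    by (auto simp: in_keys_iff)
  then have "lin_ext h (pm_scale c p) =
      (\<Sum>k\<in>Poly_Mapping.keys p. pm_scale (Poly_Mapping.lookup (pm_scale c p) k) (h k))"
    by (intro lin_ext_superset) auto
  also have "\<dots> = pm_scale c (lin_ext h p)"
    by (simp add: lin_ext_def pm.scale_sum_right)
  finally show "lin_ext h (pm_scale c p) = pm_scale c (lin_ext h p)" .
qed

lemma lin_ext_single [simp]: "lin_ext h (Poly_Mapping.single k c) = pm_scale c (h k)"
  by (cases "c = 0") (simp_all add: lin_ext_def)

lemma pm_push_eq_lin_ext: "pm_push f = lin_ext (\<lambda>k. Poly_Mapping.single (f k) 1)"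
  by (simp add: fun_eq_iff pm_push_def lin_ext_def)

lemma linear_pm_push: "pm_linear (pm_push f)"
  by (simp add: pm_push_eq_lin_ext linear_lin_ext)

lemma pm_push_single [simp]: "pm_push f (Poly_Mapping.single k c) = Poly_Mapping.single (f k) c"
  by (simp add: pm_push_eq_lin_ext)

lemma pm_linear_eqI:
  assumes "pm_linear f" "pm_linear g"
    "\<And>k. f (Poly_Mapping.single k 1) = g (Poly_Mapping.single k 1)"
  shows "f p = g p"
proof (rule pm_linear_eq_on_span[OF assms(1,2)])
  show "p \<in> pm.span (range (\<lambda>k. Poly_Mapping.single k 1))"
    by (simp flip: pm_keys_eq_span)
qed (use assms(3) in auto)

lemma pm_linear_compose: "pm_linear f \<Longrightarrow> pm_linear g \<Longrightarrow> pm_linear (\<lambda>x. g (f x))"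
  by (rule pm_linearI) (simp_all add: pm_linear_add pm_linear_scale)

lemma pm_linear_plus: "pm_linear f \<Longrightarrow> pm_linear g \<Longrightarrow> pm_linear (\<lambda>x. f x + g x)"
  by (rule pm_linearI) (simp_all add: pm_linear_add pm_linear_scale pm.scale_right_distrib algebra_simps)

lemma pm_linear_minus: "pm_linear f \<Longrightarrow> pm_linear g \<Longrightarrow> pm_linear (\<lambda>x. f x - g x)"
  by (rule pm_linearI) (simp_all add: pm_linear_add pm_linear_scale pm.scale_right_diff_distrib algebra_simps)

lemma pm_linear_id: "pm_linear (\<lambda>x. x)"
  by (rule pm_linearI) simp_all

lemma pm_push_compose: "pm_push (f \<circ> g) p = pm_push f (pm_push g p)"
  by (rule pm_linear_eqI) (simp_all add: linear_pm_push pm_linear_compose)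

lemma pm_push_id: "pm_push id p = p"
  by (rule pm_linear_eqI) (simp_all add: linear_pm_push pm_linear_id)


section \<open>Isomorphisms of representations\<close>

lemma complex_field_simps [simp]:
  "carrier complex_field = UNIV" "\<one>\<^bsub>complex_field\<^esub> = 1"
  "x \<otimes>\<^bsub>complex_field\<^esub> y = x * y" "x \<oplus>\<^bsub>complex_field\<^esub> y = x + y"
  by (simp_all add: complex_field_def)

lemma cring_complex_field: "cring complex_field"
proof (rule cringI)
  show "abelian_group complex_field"
  proof (rule abelian_groupI)
    show "\<exists>y\<in>carrier complex_field. y \<oplus>\<^bsub>complex_field\<^esub> x = \<zero>\<^bsub>complex_field\<^esub>" for x
      by (intro bexI[of _ "- x"]) (simp_all add: complex_field_def)
  qed (simp_all add: complex_field_def)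
  show "comm_monoid complex_field"
    by (rule comm_monoidI) auto
qed (simp add: algebra_simps)

lemma representationI:
  fixes V :: "('g, 'v) rep"
  assumes "group G" "abelian_group V"
    "\<And>c v. v \<in> carrier V \<Longrightarrow> c \<odot>\<^bsub>V\<^esub> v \<in> carrier V"
    "\<And>a b v. v \<in> carrier V \<Longrightarrow> (a + b) \<odot>\<^bsub>V\<^esub> v = a \<odot>\<^bsub>V\<^esub> v \<oplus>\<^bsub>V\<^esub> b \<odot>\<^bsub>V\<^esub> v"
    "\<And>c v w. v \<in> carrier V \<Longrightarrow> w \<in> carrier V \<Longrightarrow> c \<odot>\<^bsub>V\<^esub> (v \<oplus>\<^bsub>V\<^esub> w) = c \<odot>\<^bsub>V\<^esub> v \<oplus>\<^bsub>V\<^esub> c \<odot>\<^bsub>V\<^esub> w"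
    "\<And>a b v. v \<in> carrier V \<Longrightarrow> (a * b) \<odot>\<^bsub>V\<^esub> v = a \<odot>\<^bsub>V\<^esub> (b \<odot>\<^bsub>V\<^esub> v)"
    "\<And>v. v \<in> carrier V \<Longrightarrow> 1 \<odot>\<^bsub>V\<^esub> v = v"
    "\<And>g v. g \<in> carrier G \<Longrightarrow> v \<in> carrier V \<Longrightarrow> act V g v \<in> carrier V"
    "\<And>g v w. g \<in> carrier G \<Longrightarrow> v \<in> carrier V \<Longrightarrow> w \<in> carrier V
      \<Longrightarrow> act V g (v \<oplus>\<^bsub>V\<^esub> w) = act V g v \<oplus>\<^bsub>V\<^esub> act V g w"
    "\<And>g c v. g \<in> carrier G \<Longrightarrow> v \<in> carrier V \<Longrightarrow> act V g (c \<odot>\<^bsub>V\<^esub> v) = c \<odot>\<^bsub>V\<^esub> act V g v"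
    "\<And>v. v \<in> carrier V \<Longrightarrow> act V \<one>\<^bsub>G\<^esub> v = v"
    "\<And>g h v. g \<in> carrier G \<Longrightarrow> h \<in> carrier G \<Longrightarrow> v \<in> carrier V
      \<Longrightarrow> act V (g \<otimes>\<^bsub>G\<^esub> h) v = act V g (act V h v)"
  shows "representation G V"
proof -
  have "Module.module complex_field V"
    by (rule Module.moduleI) (use assms cring_complex_field in auto)
  then show ?thesis
    using assms by (auto intro!: representation.intro representation_axioms.intro)
qed

text \<open>All axioms of a representation pull back along the injection \<open>f\<close>, and
  negatives exist in \<open>V\<close> because \<open>f\<close> is onto. So only \<open>W\<close> has
  to be known as a representation, together with closure of the operations of \<open>V\<close>. The
  quotient representations thus need no separate verification.\<close>

lemma rep_isomorphicI:
  fixes V :: "('g, 'v) rep" and W :: "('g, 'w) rep"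
  assumes W: "representation G W"
    and bij: "bij_betw f (carrier V) (carrier W)"
    and zero: "\<zero>\<^bsub>V\<^esub> \<in> carrier V" "f \<zero>\<^bsub>V\<^esub> = \<zero>\<^bsub>W\<^esub>"
    and add: "\<And>v w. v \<in> carrier V \<Longrightarrow> w \<in> carrier V \<Longrightarrow>
      v \<oplus>\<^bsub>V\<^esub> w \<in> carrier V \<and> f (v \<oplus>\<^bsub>V\<^esub> w) = f v \<oplus>\<^bsub>W\<^esub> f w"
    and smult: "\<And>c v. v \<in> carrier V \<Longrightarrow>
      c \<odot>\<^bsub>V\<^esub> v \<in> carrier V \<and> f (c \<odot>\<^bsub>V\<^esub> v) = c \<odot>\<^bsub>W\<^esub> f v"
    and act: "\<And>g v. g \<in> carrier G \<Longrightarrow> v \<in> carrier V \<Longrightarrow>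
      act V g v \<in> carrier V \<and> f (act V g v) = act W g (f v)"
  shows "rep_isomorphic G V W"
proof -
  interpret W: representation G W by fact
  have inj: "v = w" if "v \<in> carrier V" "w \<in> carrier V" "f v = f w" for v w
    using bij that by (auto simp: bij_betw_def inj_on_def)
  have f: "f v \<in> carrier W" if "v \<in> carrier V" for v
    using bij that by (auto simp: bij_betw_def)
  have "abelian_group V"
  proof (rule abelian_groupI)
    fix v assume v: "v \<in> carrier V"
    have "\<ominus>\<^bsub>W\<^esub> f v \<in> f ` carrier V"
      using bij f[OF v] by (simp add: bij_betw_def)
    then obtain w where "w \<in> carrier V" "f w = \<ominus>\<^bsub>W\<^esub> f v"
      by force
    then show "\<exists>w\<in>carrier V. w \<oplus>\<^bsub>V\<^esub> v = \<zero>\<^bsub>V\<^esub>"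
      using v f[OF v] zero add by (intro bexI[of _ w] inj) (auto simp: W.V.l_neg)
  qed (use zero add f in \<open>auto intro!: inj simp: W.V.a_ac\<close>)
  have "representation G V"
    by (rule representationI)
      (use W.group_axioms \<open>abelian_group V\<close> zero add smult act f
        W.V.smult_l_distr W.V.smult_r_distr W.V.smult_assoc1 W.V.smult_one
        W.act_add W.act_smult W.act_one W.act_mult in
       \<open>auto intro!: inj\<close>)
  then show ?thesis
    using W bij add smult act f unfolding rep_isomorphic_def rep_hom_def
    by (intro conjI bexI[of _ f]) auto
qed

lemma rep_isomorphic_sym:
  assumes "rep_isomorphic G V W"
  shows "rep_isomorphic G W V"
proof -
  obtain f where f: "f \<in> rep_hom G V W" and bij: "bij_betw f (carrier V) (carrier W)"
    and V: "representation G V" and W: "representation G W"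
    using assms by (auto simp: rep_isomorphic_def)
  interpret V: representation G V by fact
  interpret W: representation G W by fact
  let ?g = "the_inv_into (carrier V) f"
  have inj: "inj_on f (carrier V)" and im: "f ` carrier V = carrier W"
    using bij by (auto simp: bij_betw_def)
  have eq: "?g w = v" if "v \<in> carrier V" "f v = w" for v w
    using that inj by (auto simp: the_inv_into_f_f)
  have ex: "\<exists>v\<in>carrier V. w = f v" if "w \<in> carrier W" for w
    using that im by auto
  have "?g \<in> rep_hom G W V"
    using f unfolding rep_hom_def
    by (auto dest!: ex intro!: eq simp: the_inv_into_f_f[OF inj] V.act_closed)
  then show ?thesis
    using V W bij_betw_the_inv_into[OF bij] by (auto simp: rep_isomorphic_def)
qed

lemma rep_isomorphic_trans:
  assumes "rep_isomorphic G U V" "rep_isomorphic G V W"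
  shows "rep_isomorphic G U W"
proof -
  obtain f g where f: "f \<in> rep_hom G U V" "bij_betw f (carrier U) (carrier V)"
    and g: "g \<in> rep_hom G V W" "bij_betw g (carrier V) (carrier W)"
    using assms by (auto simp: rep_isomorphic_def)
  have "g \<circ> f \<in> rep_hom G U W"
    using f(1) g(1) by (auto simp: rep_hom_def Pi_iff)
  then show ?thesis
    using assms bij_betw_trans[OF f(2) g(2)] by (auto simp: rep_isomorphic_def)
qed

section \<open>Cosets of a subspace and the first isomorphism theorem\<close>

abbreviation pm_coset :: "('a \<Rightarrow>\<^sub>0 complex) set \<Rightarrow> ('a \<Rightarrow>\<^sub>0 complex) \<Rightarrow> ('a \<Rightarrow>\<^sub>0 complex) set"
  where "pm_coset N p \<equiv> (\<lambda>x. x + p) ` N"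

lemma pm_coset_eq_iff:
  assumes "pm.subspace N"
  shows "pm_coset N p = pm_coset N q \<longleftrightarrow> p - q \<in> N"
proof
  assume "pm_coset N p = pm_coset N q"
  then have "0 + p \<in> pm_coset N q"
    using pm.subspace_0[OF assms] by blast
  then show "p - q \<in> N" by auto
next
  assume *: "p - q \<in> N"
  have "\<exists>y\<in>N. x + p = y + q" if "x \<in> N" for x
    using that * pm.subspace_add[OF assms that *] by (intro bexI[of _ "x + (p - q)"]) auto
  moreover have "\<exists>y\<in>N. x + q = y + p" if "x \<in> N" for x
    using that * pm.subspace_diff[OF assms that *] by (intro bexI[of _ "x - (p - q)"]) auto
  ultimately show "pm_coset N p = pm_coset N q" by (auto simp: image_iff)
qed

lemma a_r_coset_eq_pm_coset:
  assumes "add M = (+)"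
  shows "N +>\<^bsub>M\<^esub> p = pm_coset N p"
  using assms by (auto simp: a_r_coset_def')

lemma set_add_pm_coset:
  assumes "add M = (+)" "pm.subspace N"
  shows "set_add M (pm_coset N p) (pm_coset N q) = pm_coset N (p + q)"
proof -
  have "\<exists>z\<in>N. x + p + (y + q) = z + (p + q)" if "x \<in> N" "y \<in> N" for x y
    using that pm.subspace_add[OF assms(2) that] by (intro bexI[of _ "x + y"]) auto
  moreover have "\<exists>x\<in>N. \<exists>y\<in>N. z + (p + q) = x + p + (y + q)" if "z \<in> N" for z
    using that pm.subspace_0[OF assms(2)] by (intro bexI[of _ z] bexI[of _ 0]) auto
  ultimately show ?thesis
    using assms(1) by (auto simp: set_add_defs image_iff)
qed

lemma quot_map_pm_coset:
  assumes "add M = (+)" "pm.subspace N" "\<And>x y. f (x + y) = f x + f y" "\<And>x. x \<in> N \<Longrightarrow> f x \<in> N"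
  shows "quot_map M N f (pm_coset N p) = pm_coset N (f p)"
proof -
  have "pm_coset N (f (x + p)) = pm_coset N (f p)" if "x \<in> N" for x
    using assms that by (subst pm_coset_eq_iff) auto
  then show ?thesis
    using pm.subspace_0[OF assms(2)]
    by (auto simp: quot_map_def a_r_coset_eq_pm_coset[OF assms(1)])
qed

text \<open>First isomorphism theorem on representatives. \<open>C\<close> need not contain
  \<open>N\<close>: for the cohomology, \<open>C\<close> is spanned by words of length one while
  \<open>N\<close> is the full ideal. The hypothesis on the action asks only for some representative
  \<open>q\<close>, which suits an action on cosets that is not induced by a known map on
  \<open>C\<close>.\<close>

lemma rep_isomorphic_quotientI:
  fixes V :: "('g, ('a \<Rightarrow>\<^sub>0 complex) set) rep" and W :: "('g, 'w) rep"
  assumes W: "representation G W" and N: "pm.subspace N" and C: "pm.subspace C"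
    and V: "carrier V = pm_coset N ` C" "\<zero>\<^bsub>V\<^esub> = N"
      "\<And>p q. p \<in> C \<Longrightarrow> q \<in> C \<Longrightarrow> pm_coset N p \<oplus>\<^bsub>V\<^esub> pm_coset N q = pm_coset N (p + q)"
      "\<And>c p. p \<in> C \<Longrightarrow> c \<odot>\<^bsub>V\<^esub> pm_coset N p = pm_coset N (pm_scale c p)"
    and F: "F ` C = carrier W"
      "\<And>p q. p \<in> C \<Longrightarrow> q \<in> C \<Longrightarrow> F (p + q) = F p \<oplus>\<^bsub>W\<^esub> F q"
      "\<And>c p. p \<in> C \<Longrightarrow> F (pm_scale c p) = c \<odot>\<^bsub>W\<^esub> F p"
      "\<And>p. p \<in> C \<Longrightarrow> F p = \<zero>\<^bsub>W\<^esub> \<longleftrightarrow> p \<in> N"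
    and act: "\<And>g p. g \<in> carrier G \<Longrightarrow> p \<in> C \<Longrightarrow>
      \<exists>q\<in>C. act V g (pm_coset N p) = pm_coset N q \<and> F q = act W g (F p)"
  shows "rep_isomorphic G V W"
proof -
  interpret W: representation G W by fact
  have carr: "F p \<in> carrier W" if "p \<in> C" for p
    using that F(1) by auto
  have eq_iff: "F p = F q \<longleftrightarrow> p - q \<in> N" if "p \<in> C" "q \<in> C" for p q
  proof -
    have pq: "p - q \<in> C" using that C by (simp add: pm.subspace_diff)
    have p: "F p = F (p - q) \<oplus>\<^bsub>W\<^esub> F q" using F(2)[OF pq that(2)] by simp
    show ?thesis
      using F(4)[OF pq] carr[OF pq] carr[OF that(2)] W.V.add.r_cancel_one[of "F q" "F (p - q)"]
      unfolding p by simp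
  qed
  \<comment> \<open>Two representatives in \<open>C\<close> of the same coset have the same value
    under \<open>F\<close>, so the choice does not matter.\<close>
  define f where "f = (\<lambda>X. F (SOME p. p \<in> C \<and> pm_coset N p = X))"
  have f: "f (pm_coset N p) = F p" if "p \<in> C" for p
  proof -
    have "(SOME q. q \<in> C \<and> pm_coset N q = pm_coset N p) \<in> C \<and>
      pm_coset N (SOME q. q \<in> C \<and> pm_coset N q = pm_coset N p) = pm_coset N p"
      by (rule someI[of _ p]) (use that in simp)
    then show ?thesis
      unfolding f_def using eq_iff[OF _ that] pm_coset_eq_iff[OF N] by simp
  qed
  show ?thesis
  proof (rule rep_isomorphicI[where f = f])
    show "bij_betw f (carrier V) (carrier W)"
    proof (rule bij_betw_imageI)
      show "inj_on f (carrier V)"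
      proof (rule inj_onI)
        fix X Y assume X: "X \<in> carrier V" and Y: "Y \<in> carrier V" and XY: "f X = f Y"
        obtain p q where "p \<in> C" "X = pm_coset N p" "q \<in> C" "Y = pm_coset N q"
          using X Y unfolding V(1) by blast
        with XY show "X = Y"
          using f eq_iff pm_coset_eq_iff[OF N] by metis
      qed
      show "f ` carrier V = carrier W"
        using f unfolding V(1) F(1)[symmetric] image_image by (intro image_cong) auto
    qed
    have N0: "N = pm_coset N 0" by simp
    have "0 \<in> C" "0 \<in> N" using C N by (auto simp: pm.subspace_0)
    then show "\<zero>\<^bsub>V\<^esub> \<in> carrier V" "f \<zero>\<^bsub>V\<^esub> = \<zero>\<^bsub>W\<^esub>"
      unfolding V(1,2) using N0 f[of 0] F(4)[of 0] by (auto intro: image_eqI[of _ _ 0])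
    fix v assume "v \<in> carrier V"
    then obtain p where p: "p \<in> C" "v = pm_coset N p"
      unfolding V(1) by blast
    show "c \<odot>\<^bsub>V\<^esub> v \<in> carrier V \<and> f (c \<odot>\<^bsub>V\<^esub> v) = c \<odot>\<^bsub>W\<^esub> f v" for c
      using p C f V(4) F(3) unfolding V(1) by (simp add: pm.subspace_scale)
    show "act V g v \<in> carrier V \<and> f (act V g v) = act W g (f v)" if g: "g \<in> carrier G" for g
    proof -
      obtain q where "q \<in> C" "act V g (pm_coset N p) = pm_coset N q" "F q = act W g (F p)"
        using act[OF g p(1)] by blast
      then show ?thesis using p f unfolding V(1) by simp
    qed
    fix w assume "w \<in> carrier V"
    then obtain q where q: "q \<in> C" "w = pm_coset N q"
      unfolding V(1) by blast
    show "v \<oplus>\<^bsub>V\<^esub> w \<in> carrier V \<and> f (v \<oplus>\<^bsub>V\<^esub> w) = f v \<oplus>\<^bsub>W\<^esub> f w"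
      using p q C f V(3) F(2) unfolding V(1) by (simp add: pm.subspace_add)
  qed (rule W)
qed

section \<open>Specht modules of hooks\<close>

lemma single_one_eq_iff:
  "Poly_Mapping.single k (1 :: complex) = Poly_Mapping.single l 1 \<longleftrightarrow> k = l"
  by (metis lookup_single_eq lookup_single_not_eq zero_neq_one)

text \<open>\<open>r\<close> counts the cells below the corner, so the first column has
  \<open>r + 1\<close> cells.\<close>

abbreviation hook :: "nat \<Rightarrow> nat \<Rightarrow> nat list"
  where "hook k r \<equiv> k # replicate r (Suc 0)"

lemma diagram_hook:
  assumes "k \<ge> 1"
  shows "diagram (hook k r) = (\<lambda>i. (i, 0)) ` {..r} \<union> Pair 0 ` {1..<k}"
  using assms by (force simp: diagram_def nth_Cons split: nat.splits)

text \<open>Every column except the first has a single cell, so a permutation that preserves columns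
  fixes all entries outside the first column and is arbitrary on it.\<close>

lemma column_stabilizer_hook:
  assumes t: "t \<in> tableaux X (hook k r)" and k: "k \<ge> 1"
  shows "column_stabilizer X (hook k r) t = {s. s permutes (\<lambda>i. t (i, 0)) ` {..r}}"
proof (intro equalityI subsetI)
  let ?D = "diagram (hook k r)" and ?A = "(\<lambda>i. t (i, 0)) ` {..r}"
  have bij: "bij_betw t ?D X" using t by (simp add: tableaux_def)
  have col0: "(i, 0) \<in> ?D \<longleftrightarrow> i \<le> r" for i
    using k by (auto simp: diagram_hook)
  have colj: "j > 0 \<Longrightarrow> (i, j) \<in> ?D \<longleftrightarrow> i = 0 \<and> j < k" for i j
    using k by (auto simp: diagram_hook)
  have A: "?A \<subseteq> X"
    using bij col0 by (auto simp: bij_betw_def)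
  fix s
  {
    assume "s \<in> column_stabilizer X (hook k r) t"
    then have s: "s permutes X"
      and *: "\<And>i j. (i, j) \<in> ?D \<Longrightarrow> \<exists>i'. (i', j) \<in> ?D \<and> s (t (i, j)) = t (i', j)"
      by (auto simp: column_stabilizer_def)
    have "s x = x" if x: "x \<in> X - ?A" for x
    proof -
      obtain i j where ij: "(i, j) \<in> ?D" "x = t (i, j)"
        using x bij by (auto simp: bij_betw_def)
      then have "j > 0" using x col0 by (cases j) auto
      then show ?thesis using *[OF ij(1)] ij colj by auto
    qed
    then have "s permutes ?A"
      by (rule permutes_superset[OF s]) auto
    then show "s \<in> {s. s permutes ?A}" by simp
  next
    assume "s \<in> {s. s permutes ?A}"
    then have s: "s permutes ?A" by simp
    have "\<exists>i'. (i', j) \<in> ?D \<and> s (t (i, j)) = t (i', j)" if ij: "(i, j) \<in> ?D" for i j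
    proof (cases "j = 0")
      case True
      then have "s (t (i, j)) \<in> ?A"
        using ij col0 by (simp add: permutes_in_image[OF s])
      then show ?thesis using True col0 by auto
    next
      case False
      have "t (i, j) \<noteq> t (i', 0)" if "i' \<le> r" for i'
        using bij_betw_imp_inj_on[OF bij] ij False that col0 by (auto dest: inj_onD)
      then have "s (t (i, j)) = t (i, j)"
        by (intro permutes_not_in[OF s]) auto
      then show ?thesis using ij by blast
    qed
    then show "s \<in> column_stabilizer X (hook k r) t"
      using permutes_subset[OF s A] by (auto simp: column_stabilizer_def)
  }
qed

text \<open>The entries not placed in the first column number
  \<open>k + r - (r + 1) = k - 1\<close>, exactly the length of the rest of the first row, and may
  be put there in any order.\<close>

lemma ex_tableau_hook:
  assumes X: "finite X" "card X = k + r" and k: "k \<ge> 1"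
    and x: "inj_on x {..r}" "x ` {..r} \<subseteq> X"
  shows "\<exists>t\<in>tableaux X (hook k r). \<forall>i\<le>r. t (i, 0) = x i"
proof -
  have "card (X - x ` {..r}) = k - 1"
    using X x k by (simp add: card_Diff_subset card_image)
  also have "\<dots> = card (Pair (0::nat) ` {1..<k})"
    by (simp add: card_image inj_on_def)
  finally obtain h where h: "bij_betw h (Pair (0::nat) ` {1..<k}) (X - x ` {..r})"
    using X(1) by (metis finite_Diff finite_atLeastLessThan finite_imageI finite_same_card_bij)
  define t where "t = (\<lambda>c. if snd c = 0 then x (fst c) else h c)"
  have "bij_betw t ((\<lambda>i. (i, 0)) ` {..r}) (x ` {..r})"
  proof (rule bij_betw_imageI)
    show "t ` (\<lambda>i. (i, 0)) ` {..r} = x ` {..r}"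
      unfolding image_image by (rule image_cong) (simp_all add: t_def)
  qed (use x(1) in \<open>auto simp: inj_on_def t_def\<close>)
  moreover have "bij_betw t (Pair 0 ` {1..<k}) (X - x ` {..r})"
    using h by (subst bij_betw_cong[of _ _ h]) (auto simp: t_def)
  ultimately have "bij_betw t (diagram (hook k r)) (x ` {..r} \<union> (X - x ` {..r}))"
    unfolding diagram_hook[OF k] by (rule bij_betw_combine) auto
  moreover have "x ` {..r} \<union> (X - x ` {..r}) = X" using x(2) by auto
  ultimately show ?thesis
    by (intro bexI[of _ t]) (auto simp: tableaux_def t_def)
qed

text \<open>The last claim is what makes tabloids of hooks easy to handle: the first row, as a set,
  is the complement of the entries below the corner and carries no further information.\<close>

lemma tableau_hookD:
  assumes t: "t \<in> tableaux X (hook k r)" and k: "k \<ge> 1"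
  shows "inj_on (\<lambda>i. t (i, 0)) {..r}" "(\<lambda>i. t (i, 0)) ` {..r} \<subseteq> X"
    "(\<lambda>j. t (0, j)) ` {..<k} = X - (\<lambda>i. t (i, 0)) ` {1..r}"
proof -
  have bij: "bij_betw t (diagram (hook k r)) X" using t by (simp add: tableaux_def)
  then show "inj_on (\<lambda>i. t (i, 0)) {..r}" "(\<lambda>i. t (i, 0)) ` {..r} \<subseteq> X"
    using k by (auto simp: diagram_hook bij_betw_def inj_on_def)
  have D: "Pair 0 ` {..<k} = diagram (hook k r) - (\<lambda>i. (i, 0)) ` {1..r}"
    "(\<lambda>i. (i, 0)) ` {1..r} \<subseteq> diagram (hook k r)"
    using k by (force simp: diagram_hook)+
  have "t ` Pair 0 ` {..<k} = X - t ` (\<lambda>i. (i, 0)) ` {1..r}"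
    unfolding D(1) using bij D(2) by (subst inj_on_image_set_diff) (auto simp: bij_betw_def)
  then show "(\<lambda>j. t (0, j)) ` {..<k} = X - (\<lambda>i. t (i, 0)) ` {1..r}"
    by (simp add: image_image)
qed

section \<open>Explicit polytabloids of hooks with one or two cells below the corner\<close>

definition tab1 :: "nat set \<Rightarrow> nat \<Rightarrow> (nat set list \<Rightarrow>\<^sub>0 complex)"
  where "tab1 X x = Poly_Mapping.single [X - {x}, {x}] 1"

text \<open>For \<open>x = y\<close> this is not a tabloid. Such terms cancel in
  \<open>alt2\<close>, so no distinctness conditions have to be carried along.\<close>

definition tab2 :: "nat set \<Rightarrow> nat \<Rightarrow> nat \<Rightarrow> (nat set list \<Rightarrow>\<^sub>0 complex)"
  where "tab2 X x y = Poly_Mapping.single [X - {x, y}, {x}, {y}] 1"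

definition alt2 :: "nat set \<Rightarrow> nat \<Rightarrow> nat \<Rightarrow> (nat set list \<Rightarrow>\<^sub>0 complex)"
  where "alt2 X x y = tab2 X x y - tab2 X y x"

definition alt3 :: "nat set \<Rightarrow> nat \<Rightarrow> nat \<Rightarrow> nat \<Rightarrow> (nat set list \<Rightarrow>\<^sub>0 complex)"
  where "alt3 X a b c = alt2 X a b + alt2 X b c + alt2 X c a"

lemma polytabloid_hook1:
  assumes t: "t \<in> tableaux X [k, 1]" and k: "k \<ge> 1"
  shows "polytabloid X [k, 1] t = tab1 X (t (1, 0)) - tab1 X (t (0, 0))"
proof -
  let ?a = "t (0, 0)" and ?b = "t (1, 0)"
  have hook: "[k, 1] = hook k 1" by simp
  have t': "t \<in> tableaux X (hook k 1)" using t by simp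
  have "{..1::nat} = {0, 1}" "{1..1::nat} = {1}" by auto
  note * = tableau_hookD[OF t' k, unfolded this]
  have ab: "?a \<noteq> ?b" and X: "?a \<in> X" "?b \<in> X"
    using * by auto
  have row: "(\<lambda>j. t (0, j)) ` {..<k} = X - {?b}"
    using * by simp
  have stab: "column_stabilizer X [k, 1] t = {s. s permutes {?a, ?b}}"
    unfolding hook column_stabilizer_hook[OF t' k] by (simp add: atMost_Suc insert_commute)
  have act: "tabloid_act s (tabloid [k, 1] t) = [X - {s ?b}, {s ?b}]" if "s permutes {?a, ?b}" for s
  proof -
    have s: "s permutes X"
      by (rule permutes_subset[OF that]) (use X in auto)
    have "s ` (X - {?b}) = X - {s ?b}"
      using permutes_inj[OF s] permutes_image[OF s] by (simp add: image_set_diff)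
    then show ?thesis
      by (simp add: tabloid_act_def tabloid_def row lessThan_Suc)
  qed
  have "polytabloid X [k, 1] t = (\<Sum>s | s permutes {?a, ?b}. pm_scale (of_int (sign s)) (tab1 X (s ?b)))"
    unfolding polytabloid_def stab by (rule sum.cong) (simp_all add: act tab1_def del: One_nat_def)
  also have "\<dots> = tab1 X ?b - tab1 X ?a"
    using ab by (simp add: sum_over_permutations_insert sign_compose sign_swap_id permutation_swap_id)
  finally show ?thesis .
qed

text \<open>A tabloid records only the images of \<open>?b\<close> and \<open>?c\<close>. The three
  even permutations of the column yield the pairs \<open>(?b, ?c)\<close>, \<open>(?c, ?a)\<close>,
  \<open>(?a, ?b)\<close>; the odd ones yield the reversed pairs with a minus sign. Each pair
  combines with its reverse to one \<open>alt2\<close>.\<close>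

lemma polytabloid_hook2:
  assumes t: "t \<in> tableaux X [k, 1, 1]" and k: "k \<ge> 1"
  shows "polytabloid X [k, 1, 1] t = alt3 X (t (0, 0)) (t (1, 0)) (t (2, 0))"
proof -
  let ?a = "t (0, 0)" and ?b = "t (1, 0)" and ?c = "t (2, 0)"
  have hook: "[k, 1, 1] = hook k 2" by (simp add: numeral_2_eq_2)
  have t': "t \<in> tableaux X (hook k 2)" using t hook by simp
  have "{..2::nat} = {0, 1, 2}" "{1..2::nat} = {1, 2}" by auto
  note * = tableau_hookD[OF t' k, unfolded this]
  have ne: "?a \<noteq> ?b" "?a \<noteq> ?c" "?b \<noteq> ?c" and X: "?a \<in> X" "?b \<in> X" "?c \<in> X"
    using * by auto
  have row: "(\<lambda>j. t (0, j)) ` {..<k} = X - {?b, ?c}"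
    using * by simp
  have stab: "column_stabilizer X [k, 1, 1] t = {s. s permutes {?a, ?b, ?c}}"
    unfolding hook column_stabilizer_hook[OF t' k]
    by (simp add: atMost_Suc insert_commute numeral_2_eq_2)
  have act: "tabloid_act s (tabloid [k, 1, 1] t) = [X - {s ?b, s ?c}, {s ?b}, {s ?c}]"
    if "s permutes {?a, ?b, ?c}" for s
  proof -
    have s: "s permutes X"
      by (rule permutes_subset[OF that]) (use X in auto)
    have "s ` (X - {?b, ?c}) = X - {s ?b, s ?c}"
      using permutes_inj[OF s] permutes_image[OF s] by (simp add: image_set_diff)
    then show ?thesis
      by (simp add: tabloid_act_def tabloid_def row numeral_2_eq_2 lessThan_Suc)
  qed
  have "polytabloid X [k, 1, 1] t =
      (\<Sum>s | s permutes {?a, ?b, ?c}. pm_scale (of_int (sign s)) (tab2 X (s ?b) (s ?c)))"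
    unfolding polytabloid_def stab by (rule sum.cong) (simp_all add: act tab2_def del: One_nat_def)
  also have "\<dots> = alt3 X ?a ?b ?c"
    using ne by (simp add: sum_over_permutations_insert sign_compose sign_swap_id permutation_swap_id
        permutation_compose alt3_def alt2_def transpose_def)
  finally show ?thesis .
qed

lemma alt2_swap: "alt2 X y x = - alt2 X x y"
  by (simp add: alt2_def)

lemma alt2_same [simp]: "alt2 X x x = 0"
  by (simp add: alt2_def)

lemma alt3_same [simp]: "alt3 X a a c = 0" "alt3 X a b b = 0" "alt3 X a b a = 0"
  using alt2_swap[of X a c] alt2_swap[of X a b] by (simp_all add: alt3_def)

lemma alt3_swap: "alt3 X b a c = - alt3 X a b c" "alt3 X a c b = - alt3 X a b c"
  using alt2_swap[of X a c] alt2_swap[of X a b] alt2_swap[of X b c] by (simp_all add: alt3_def)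

text \<open>Read \<open>alt2\<close> as an oriented edge and \<open>alt3\<close> as the boundary of
  a triangle. In the three triangles with apex \<open>z\<close> the edges through \<open>z\<close>
  cancel in pairs, and the boundary of the opposite face remains.\<close>

lemma alt3_cocycle: "alt3 X a b c = alt3 X z a b + alt3 X z b c + alt3 X z c a"
  using alt2_swap[of X z a] alt2_swap[of X z b] alt2_swap[of X z c] by (simp add: alt3_def)

text \<open>Coinciding indices contribute only the zero vector, which does not affect a span.
  Admitting them frees all later arguments from distinctness conditions.\<close>

lemma carrier_specht_hook1:
  assumes "finite X" "card X = k + 1" "k \<ge> 1"
  shows "carrier (specht X [k, 1]) = pm.span {tab1 X b - tab1 X a | a b. a \<in> X \<and> b \<in> X}"
proof -
  have "polytabloid X [k, 1] ` tableaux X [k, 1] = {tab1 X b - tab1 X a | a b. a \<in> X \<and> b \<in> X} - {0}"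
  proof (intro equalityI subsetI)
    fix p assume "p \<in> polytabloid X [k, 1] ` tableaux X [k, 1]"
    then obtain t where t: "t \<in> tableaux X (hook k 1)" "p = polytabloid X [k, 1] t" by auto
    then have "p = tab1 X (t (1, 0)) - tab1 X (t (0, 0))"
      using polytabloid_hook1 assms(3) by simp
    moreover have "t (0, 0) \<noteq> t (1, 0)" "t (0, 0) \<in> X" "t (1, 0) \<in> X"
      using tableau_hookD[OF t(1) assms(3)] by (auto simp: inj_on_def)
    ultimately show "p \<in> {tab1 X b - tab1 X a | a b. a \<in> X \<and> b \<in> X} - {0}"
      by (auto simp: tab1_def single_one_eq_iff)
  next
    fix p assume "p \<in> {tab1 X b - tab1 X a | a b. a \<in> X \<and> b \<in> X} - {0}"
    then obtain a b where ab: "p = tab1 X b - tab1 X a" "a \<in> X" "b \<in> X" and "p \<noteq> 0" by blast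
    then have "a \<noteq> b" by auto
    let ?x = "\<lambda>i::nat. if i = 0 then a else b"
    have "inj_on ?x {..1}" "?x ` {..1} \<subseteq> X"
      using ab \<open>a \<noteq> b\<close> by (auto simp: inj_on_def)
    from ex_tableau_hook[OF assms this]
    obtain t where t: "t \<in> tableaux X (hook k 1)" "\<forall>i\<le>1. t (i, 0) = ?x i" by blast
    then have "t (0, 0) = a" "t (1, 0) = b" by auto
    then have "p = polytabloid X [k, 1] t"
      using polytabloid_hook1[of t X k] t(1) assms(3) ab(1) by simp
    then show "p \<in> polytabloid X [k, 1] ` tableaux X [k, 1]"
      using t(1) by auto
  qed
  then show ?thesis
    by (simp add: specht_def pm.span_delete_0)
qed

text \<open>The set of polytabloids lies between \<open>?S - {0}\<close> and \<open>?S\<close>, so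
  the spans agree. Two inclusions suffice, and it need not be decided whether \<open>alt3\<close> of
  distinct points is nonzero.\<close>

lemma carrier_specht_hook2:
  assumes "finite X" "card X = k + 2" "k \<ge> 1"
  shows "carrier (specht X [k, 1, 1]) =
    pm.span {alt3 X a b c | a b c. a \<in> X \<and> b \<in> X \<and> c \<in> X}"
proof -
  let ?S = "{alt3 X a b c | a b c. a \<in> X \<and> b \<in> X \<and> c \<in> X}"
  have hook: "[k, 1, 1] = hook k 2" by (simp add: numeral_2_eq_2)
  have "polytabloid X [k, 1, 1] ` tableaux X [k, 1, 1] \<subseteq> ?S"
  proof
    fix p assume "p \<in> polytabloid X [k, 1, 1] ` tableaux X [k, 1, 1]"
    then obtain t where t: "t \<in> tableaux X (hook k 2)" "p = polytabloid X [k, 1, 1] t"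
      unfolding hook by blast
    then have "p = alt3 X (t (0, 0)) (t (1, 0)) (t (2, 0))"
      using polytabloid_hook2 assms(3) hook by simp
    moreover have "t (0, 0) \<in> X" "t (1, 0) \<in> X" "t (2, 0) \<in> X"
      using tableau_hookD(2)[OF t(1) assms(3)] by auto
    ultimately show "p \<in> ?S" by blast
  qed
  moreover have "?S - {0} \<subseteq> polytabloid X [k, 1, 1] ` tableaux X [k, 1, 1]"
  proof
    fix p assume "p \<in> ?S - {0}"
    then obtain a b c where abc: "p = alt3 X a b c" "a \<in> X" "b \<in> X" "c \<in> X" and "p \<noteq> 0" by blast
    then have "a \<noteq> b" "a \<noteq> c" "b \<noteq> c" by auto
    let ?x = "\<lambda>i::nat. if i = 0 then a else if i = 1 then b else c"
    have "inj_on ?x {..2}" "?x ` {..2} \<subseteq> X"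
      using abc \<open>a \<noteq> b\<close> \<open>a \<noteq> c\<close> \<open>b \<noteq> c\<close> by (auto simp: inj_on_def)
    from ex_tableau_hook[OF assms this]
    obtain t where t: "t \<in> tableaux X (hook k 2)" "\<forall>i\<le>2. t (i, 0) = ?x i" by blast
    then have "t (0, 0) = a" "t (1, 0) = b" "t (2, 0) = c" by auto
    then have "p = polytabloid X [k, 1, 1] t"
      using polytabloid_hook2[of t X k] t(1) assms(3) abc(1) hook by simp
    then show "p \<in> polytabloid X [k, 1, 1] ` tableaux X [k, 1, 1]"
      using t(1) hook by auto
  qed
  ultimately have "pm.span (polytabloid X [k, 1, 1] ` tableaux X [k, 1, 1]) = pm.span ?S"
    using pm.span_mono[of _ ?S] pm.span_mono[of "?S - {0}"] unfolding pm.span_delete_0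
    by (intro subset_antisym)
  then show ?thesis by (simp add: specht_def)
qed

section \<open>The action of the symmetric group on hook Specht modules\<close>

lemma push_tab1:
  assumes "s permutes X"
  shows "pm_push (tabloid_act s) (tab1 X x) = tab1 X (s x)"
  using permutes_inj[OF assms] permutes_image[OF assms]
  by (simp add: tab1_def tabloid_act_def image_set_diff)

lemma push_tab2:
  assumes "s permutes X"
  shows "pm_push (tabloid_act s) (tab2 X x y) = tab2 X (s x) (s y)"
  using permutes_inj[OF assms] permutes_image[OF assms]
  by (simp add: tab2_def tabloid_act_def image_set_diff)

lemma push_alt2:
  assumes "s permutes X"
  shows "pm_push (tabloid_act s) (alt2 X x y) = alt2 X (s x) (s y)"
  using assms by (simp add: alt2_def pm_linear_diff[OF linear_pm_push] push_tab2)

lemma push_alt3: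
  assumes "s permutes X"
  shows "pm_push (tabloid_act s) (alt3 X a b c) = alt3 X (s a) (s b) (s c)"
  using assms by (simp add: alt3_def pm_linear_add[OF linear_pm_push] push_alt2)

lemma group_sym_group_on: "group (sym_group_on X)"
proof (rule groupI)
  fix p assume "p \<in> carrier (sym_group_on X)"
  then show "\<exists>q\<in>carrier (sym_group_on X). q \<otimes>\<^bsub>sym_group_on X\<^esub> p = \<one>\<^bsub>sym_group_on X\<^esub>"
    by (intro bexI[of _ "Hilbert_Choice.inv p"])
      (auto simp: sym_group_on_def permutes_inv_o permutes_inv)
qed (auto simp: sym_group_on_def permutes_compose permutes_id o_assoc)

text \<open>The formulas for scalars and action are required only on the carrier. In this form the
  lemma also covers \<open>zero_rep\<close>, whose scalar multiplication and action ignore their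
  first argument and agree with the usual ones only at the zero vector.\<close>

lemma representation_push:
  fixes V :: "(nat \<Rightarrow> nat, nat set list \<Rightarrow>\<^sub>0 complex) rep"
  assumes V: "carrier V = pm.span S" "\<zero>\<^bsub>V\<^esub> = 0" "add V = (+)"
      "\<And>c v. v \<in> carrier V \<Longrightarrow> c \<odot>\<^bsub>V\<^esub> v = pm_scale c v"
      "\<And>s v. s permutes X \<Longrightarrow> v \<in> carrier V \<Longrightarrow> act V s v = pm_push (tabloid_act s) v"
    and S: "\<And>s v. s permutes X \<Longrightarrow> v \<in> S \<Longrightarrow> pm_push (tabloid_act s) v \<in> S"
  shows "representation (sym_group_on X) V"
proof -
  have push: "pm_push (tabloid_act s) v \<in> carrier V" if "s permutes X" "v \<in> carrier V" for s v
    unfolding V(1)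
  proof (rule pm_linear_in_subspace[OF linear_pm_push pm.subspace_span])
    show "v \<in> pm.span S" using that V(1) by simp
  qed (use S that in \<open>auto intro: pm.span_base\<close>)
  have "abelian_group V"
  proof (rule abelian_groupI)
    fix v assume "v \<in> carrier V"
    then show "\<exists>w\<in>carrier V. w \<oplus>\<^bsub>V\<^esub> v = \<zero>\<^bsub>V\<^esub>"
      unfolding V(1-3) by (intro bexI[of _ "- v"]) (auto simp: pm.span_neg)
  qed (auto simp: V(1-3) pm.span_add pm.span_zero algebra_simps)
  moreover have "tabloid_act id = id" "tabloid_act (s \<circ> t) = tabloid_act s \<circ> tabloid_act t" for s t
    by (auto simp: tabloid_act_def fun_eq_iff image_image)
  moreover have "pm_scale c v \<in> carrier V" "v + w \<in> carrier V"
    if "v \<in> carrier V" "w \<in> carrier V" for c v w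
    using that by (simp_all add: V(1) pm.span_add pm.span_scale)
  ultimately show ?thesis
    using group_sym_group_on push
    by (intro representationI)
      (simp_all add: sym_group_on_def V(2-5) pm_push_id pm_push_compose permutes_compose
        permutes_id pm.scale_left_distrib pm.scale_right_distrib
        pm_linear_add[OF linear_pm_push] pm_linear_scale[OF linear_pm_push])
qed

lemma specht_simps [simp]:
  "\<zero>\<^bsub>specht X lam\<^esub> = 0" "add (specht X lam) = (+)" "smult (specht X lam) = pm_scale"
  "act (specht X lam) = (\<lambda>s. pm_push (tabloid_act s))"
  by (simp_all add: specht_def)

lemma representation_specht_hook1:
  assumes "finite X" "card X = k + 1" "k \<ge> 1"
  shows "representation (sym_group_on X) (specht X [k, 1])"
proof (rule representation_push[OF carrier_specht_hook1[OF assms]])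
  fix s v assume s: "s permutes X" and "v \<in> {tab1 X b - tab1 X a | a b. a \<in> X \<and> b \<in> X}"
  then obtain a b where "v = tab1 X b - tab1 X a" "a \<in> X" "b \<in> X" by blast
  then have "pm_push (tabloid_act s) v = tab1 X (s b) - tab1 X (s a)" "s a \<in> X" "s b \<in> X"
    using s by (simp_all add: pm_linear_diff[OF linear_pm_push] push_tab1 permutes_in_image)
  then show "pm_push (tabloid_act s) v \<in> {tab1 X b - tab1 X a | a b. a \<in> X \<and> b \<in> X}" by blast
qed simp_all

lemma push_alt3_in:
  assumes "s permutes X" "v \<in> {alt3 X a b c | a b c. a \<in> X \<and> b \<in> X \<and> c \<in> X}"
  shows "pm_push (tabloid_act s) v \<in> {alt3 X a b c | a b c. a \<in> X \<and> b \<in> X \<and> c \<in> X}"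
proof -
  obtain a b c where "v = alt3 X a b c" "a \<in> X" "b \<in> X" "c \<in> X" using assms(2) by blast
  then have "pm_push (tabloid_act s) v = alt3 X (s a) (s b) (s c)" "s a \<in> X" "s b \<in> X" "s c \<in> X"
    using assms(1) by (simp_all add: push_alt3 permutes_in_image)
  then show ?thesis by blast
qed

lemma representation_specht_hook2:
  assumes "finite X" "card X = k + 2" "k \<ge> 1"
  shows "representation (sym_group_on X) (specht X [k, 1, 1])"
  by (rule representation_push[OF carrier_specht_hook2[OF assms]], simp_all only: push_alt3_in) simp_all

section \<open>Linear maps out of tabloid spaces and the wedge product\<close>

definition tab1_ext :: "(nat \<Rightarrow> ('b \<Rightarrow>\<^sub>0 complex)) \<Rightarrow> (nat set list \<Rightarrow>\<^sub>0 complex) \<Rightarrow> ('b \<Rightarrow>\<^sub>0 complex)"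
  where "tab1_ext h = lin_ext (\<lambda>T. h (the_elem (T ! 1)))"

text \<open>The rows with index 1 and 2 determine the tabloid, so values may be prescribed on pairs
  of points. On lists of any other shape the value is an unspecified default; in exchange the map is
  linear on the whole free space.\<close>

definition tab2_ext ::
    "(nat \<Rightarrow> nat \<Rightarrow> ('b \<Rightarrow>\<^sub>0 complex)) \<Rightarrow> (nat set list \<Rightarrow>\<^sub>0 complex) \<Rightarrow> ('b \<Rightarrow>\<^sub>0 complex)"
  where "tab2_ext h = lin_ext (\<lambda>T. h (the_elem (T ! 1)) (the_elem (T ! 2)))"

lemma linear_tab1_ext: "pm_linear (tab1_ext h)"
  by (simp add: tab1_ext_def linear_lin_ext)

lemma linear_tab2_ext: "pm_linear (tab2_ext h)"
  by (simp add: tab2_ext_def linear_lin_ext)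

lemma tab1_ext_tab1 [simp]: "tab1_ext h (tab1 X x) = h x"
  by (simp add: tab1_ext_def tab1_def)

lemma tab2_ext_tab2 [simp]: "tab2_ext h (tab2 X x y) = h x y"
  by (simp add: tab2_ext_def tab2_def)

lemma tab2_ext_alt2 [simp]: "tab2_ext h (alt2 X x y) = h x y - h y x"
  by (simp add: alt2_def pm_linear_diff[OF linear_tab2_ext])

text \<open>An exchange of two finite sums. It turns linearity of \<open>wedge\<close> in the first
  argument into linearity in the second, and antisymmetry of \<open>alt2\<close> into antisymmetry
  of \<open>wedge\<close>.\<close>

lemma lin_ext_swap: "lin_ext (\<lambda>k. lin_ext (h k) v) u = lin_ext (\<lambda>l. lin_ext (\<lambda>k. h k l) u) v"
  unfolding lin_ext_def pm.scale_sum_right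
  by (subst sum.swap) (simp add: mult.commute)


section \<open>The exterior square of the standard representation\<close>

definition wedge :: "nat set \<Rightarrow> (nat set list \<Rightarrow>\<^sub>0 complex) \<Rightarrow> (nat set list \<Rightarrow>\<^sub>0 complex) \<Rightarrow> (nat set list \<Rightarrow>\<^sub>0 complex)"
  where "wedge X u v = tab1_ext (\<lambda>x. tab1_ext (alt2 X x) v) u"

lemma linear_wedge_left: "pm_linear (\<lambda>u. wedge X u v)"
  unfolding wedge_def by (rule linear_tab1_ext)

lemma linear_wedge_right: "pm_linear (wedge X u)"
proof -
  have "wedge X u = tab1_ext (\<lambda>y. tab1_ext (\<lambda>x. alt2 X x y) u)"
    by (rule ext) (simp add: wedge_def tab1_ext_def lin_ext_swap[of _ _ u])
  then show ?thesis by (simp add: linear_tab1_ext)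
qed

lemma wedge_swap: "wedge X v u = - wedge X u v"
proof -
  have "wedge X v u = tab1_ext (\<lambda>y. tab1_ext (\<lambda>x. alt2 X x y) v) u"
    by (simp add: wedge_def tab1_ext_def lin_ext_swap[of _ _ v])
  also have "\<dots> = tab1_ext (\<lambda>y. tab1_ext (\<lambda>x. - alt2 X y x) v) u"
    by (subst alt2_swap) simp
  also have "\<dots> = - wedge X u v"
    by (simp add: wedge_def tab1_ext_def lin_ext_def sum_negf)
  finally show ?thesis .
qed

lemma wedge_self [simp]: "wedge X v v = 0"
proof (rule poly_mapping_eqI)
  fix k
  have "Poly_Mapping.lookup (wedge X v v) k = - Poly_Mapping.lookup (wedge X v v) k"
    by (subst wedge_swap) simp
  then show "Poly_Mapping.lookup (wedge X v v) k = Poly_Mapping.lookup 0 k" by simp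
qed

lemma wedge_tab1: "wedge X (tab1 X x) (tab1 X y) = alt2 X x y"
  by (simp add: wedge_def)

lemmas wedge_linear_simps =
  pm_linear_add[OF linear_wedge_left] pm_linear_add[OF linear_wedge_right]
  pm_linear_diff[OF linear_wedge_left] pm_linear_diff[OF linear_wedge_right]
  pm_linear_scale[OF linear_wedge_left] pm_linear_scale[OF linear_wedge_right]
  pm_linear_0[OF linear_wedge_left] pm_linear_0[OF linear_wedge_right]

lemma wedge_diff:
  "wedge X (tab1 X x - tab1 X z) (tab1 X y - tab1 X z) = alt3 X z x y"
  using alt2_swap[of X x z] by (simp add: wedge_linear_simps wedge_tab1 alt3_def alt2_swap[of X x z] alt2_swap[of X z y])

text \<open>Both sides are bilinear and agree on pairs of vectors \<open>tab1 X x\<close>. The span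
  hypotheses keep out basis lists whose row of index 1 is not a singleton, for which
  \<open>the_elem\<close> is unspecified.\<close>

lemma push_wedge:
  assumes s: "s permutes X" and "u \<in> pm.span (range (tab1 X))" "v \<in> pm.span (range (tab1 X))"
  shows "wedge X (pm_push (tabloid_act s) u) (pm_push (tabloid_act s) v) =
    pm_push (tabloid_act s) (wedge X u v)"
proof (rule pm_linear_eq_on_span[OF _ _ _ assms(2)])
  fix u' assume "u' \<in> range (tab1 X)"
  then obtain x where u': "u' = tab1 X x" by blast
  show "wedge X (pm_push (tabloid_act s) u') (pm_push (tabloid_act s) v) =
    pm_push (tabloid_act s) (wedge X u' v)"
  proof (rule pm_linear_eq_on_span[OF _ _ _ assms(3)])
    fix v' assume "v' \<in> range (tab1 X)"
    then show "wedge X (pm_push (tabloid_act s) u') (pm_push (tabloid_act s) v') =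
      pm_push (tabloid_act s) (wedge X u' v')"
      using s by (auto simp: u' push_tab1 wedge_tab1 push_alt2)
  qed (intro pm_linear_compose[OF linear_pm_push linear_wedge_right]
        pm_linear_compose[OF linear_wedge_right linear_pm_push])+
qed (intro pm_linear_compose[OF linear_pm_push linear_wedge_left]
      pm_linear_compose[OF linear_wedge_left linear_pm_push])+

text \<open>The action is left as a \<open>quot_map\<close>: evaluating it on a coset requires that
  the relations be stable under the group, which is shown later.\<close>

lemma ext_square_simps:
  fixes V :: "('g, 'v) rep"
  defines "F \<equiv> free_module (carrier V \<times> carrier V)" and "N \<equiv> pm.span (ext_square_relations V)"
  shows "carrier (ext_square V) = pm_coset N ` {p. Poly_Mapping.keys p \<subseteq> carrier V \<times> carrier V}"
    "\<zero>\<^bsub>ext_square V\<^esub> = N"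
    "pm_coset N p \<oplus>\<^bsub>ext_square V\<^esub> pm_coset N q = pm_coset N (p + q)"
    "c \<odot>\<^bsub>ext_square V\<^esub> pm_coset N p = pm_coset N (pm_scale c p)"
    "act (ext_square V) g = quot_map F N (pm_push (map_prod (act V g) (act V g)))"
proof -
  have F: "add F = (+)" "smult F = pm_scale" "carrier F = {p. Poly_Mapping.keys p \<subseteq> carrier V \<times> carrier V}"
    by (simp_all add: F_def free_module_def)
  have N: "pm.subspace N" by (simp add: N_def)
  note defs = ext_square_def Let_def module.defs rep.defs quot_module_def F_def[symmetric] N_def[symmetric]
  show "carrier (ext_square V) = pm_coset N ` {p. Poly_Mapping.keys p \<subseteq> carrier V \<times> carrier V}"
    by (auto simp: defs A_RCOSETS_def' a_r_coset_eq_pm_coset[OF F(1)] F(3))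
  show "\<zero>\<^bsub>ext_square V\<^esub> = N"
    "act (ext_square V) g = quot_map F N (pm_push (map_prod (act V g) (act V g)))"
    by (simp_all add: defs)
  show "pm_coset N p \<oplus>\<^bsub>ext_square V\<^esub> pm_coset N q = pm_coset N (p + q)"
    using set_add_pm_coset[OF F(1) N] by (simp add: defs)
  show "c \<odot>\<^bsub>ext_square V\<^esub> pm_coset N p = pm_coset N (pm_scale c p)"
    using quot_map_pm_coset[OF F(1) N, of "pm_scale c"] N
    by (simp add: defs F(2) pm.scale_right_distrib pm.subspace_scale)
qed

lemma ext_square_relationsI:
  assumes V: "add V = (+)" "smult V = pm_scale"
    and uv: "u \<in> carrier V" "v \<in> carrier V" "w \<in> carrier V"
  defines "e \<equiv> (\<lambda>u v. Poly_Mapping.single (u, v) 1)"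
  shows "e (u + v) w - e u w - e v w \<in> ext_square_relations V"
    "e u (v + w) - e u v - e u w \<in> ext_square_relations V"
    "e (pm_scale c v) w - pm_scale c (e v w) \<in> ext_square_relations V"
    "e v (pm_scale c w) - pm_scale c (e v w) \<in> ext_square_relations V"
    "e v v \<in> ext_square_relations V"
  unfolding ext_square_relations_def Let_def e_def V using uv by blast+

lemma ext_square_relationsE:
  assumes "r \<in> ext_square_relations V" and V: "add V = (+)" "smult V = pm_scale"
  obtains
    u v w where "u \<in> carrier V" "v \<in> carrier V" "w \<in> carrier V"
      "r = Poly_Mapping.single (u + v, w) 1 - Poly_Mapping.single (u, w) 1 - Poly_Mapping.single (v, w) 1"
  | u v w where "u \<in> carrier V" "v \<in> carrier V" "w \<in> carrier V"
      "r = Poly_Mapping.single (u, v + w) 1 - Poly_Mapping.single (u, v) 1 - Poly_Mapping.single (u, w) 1"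
  | c v w where "v \<in> carrier V" "w \<in> carrier V"
      "r = Poly_Mapping.single (pm_scale c v, w) 1 - pm_scale c (Poly_Mapping.single (v, w) 1)"
  | c v w where "v \<in> carrier V" "w \<in> carrier V"
      "r = Poly_Mapping.single (v, pm_scale c w) 1 - pm_scale c (Poly_Mapping.single (v, w) 1)"
  | v where "v \<in> carrier V" "r = Poly_Mapping.single (v, v) 1"
  using assms(1) unfolding ext_square_relations_def Let_def V
  apply (elim UnE CollectE exE conjE)
  subgoal for u v w by (rule that(1)[of u v w])
  subgoal for u v w by (rule that(2)[of u v w])
  subgoal for c v w by (rule that(3)[of v w c])
  subgoal for c v w by (rule that(4)[of v w c])
  subgoal for v by (rule that(5)[of v])
  done

text \<open>The size \<open>k + 2\<close> makes both \<open>[k + 1, 1]\<close> and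
  \<open>[k, 1, 1]\<close> partitions of \<open>card X\<close>. The base point \<open>z\<close>
  provides the spanning vectors \<open>D x\<close> of the standard representation;
  \<open>D z = 0\<close> is kept among them to avoid case distinctions.\<close>

locale pointed_set =
  fixes X :: "nat set" and k z :: nat
  assumes X: "finite X" "card X = k + 2" "k \<ge> 1" "z \<in> X"
begin

definition V where "V = specht X [k + 1, 1]"
definition W where "W = specht X [k, 1, 1]"

definition D where "D x = tab1 X x - tab1 X z"

lemma V_simps: "\<zero>\<^bsub>V\<^esub> = 0" "add V = (+)" "smult V = pm_scale"
  "act V = (\<lambda>s. pm_push (tabloid_act s))"
  by (simp_all add: V_def)

lemma repV: "representation (sym_group_on X) V"
  unfolding V_def using X by (intro representation_specht_hook1) auto

lemma repW: "representation (sym_group_on X) W"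
  unfolding W_def using X by (intro representation_specht_hook2) auto

lemma carrier_V: "carrier V = pm.span (D ` X)"
proof -
  have "carrier V = pm.span {tab1 X b - tab1 X a | a b. a \<in> X \<and> b \<in> X}"
    unfolding V_def using X by (intro carrier_specht_hook1) auto
  also have "\<dots> = pm.span (D ` X)"
  proof (rule pm.span_eq[THEN iffD2], intro conjI subsetI)
    fix p assume "p \<in> {tab1 X b - tab1 X a | a b. a \<in> X \<and> b \<in> X}"
    then obtain a b where "p = D b - D a" "a \<in> X" "b \<in> X" by (auto simp: D_def)
    then show "p \<in> pm.span (D ` X)" by (auto intro: pm.span_diff pm.span_base)
  next
    fix p assume "p \<in> D ` X"
    then show "p \<in> pm.span {tab1 X b - tab1 X a | a b. a \<in> X \<and> b \<in> X}"
      using X(4) by (auto simp: D_def intro!: pm.span_base)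
  qed
  finally show ?thesis .
qed

text \<open>By the cocycle identity every triangle is a sum of triangles with apex
  \<open>z\<close>.\<close>

lemma carrier_W: "carrier W = pm.span {alt3 X z x y | x y. x \<in> X \<and> y \<in> X}"
proof -
  have "carrier W = pm.span {alt3 X a b c | a b c. a \<in> X \<and> b \<in> X \<and> c \<in> X}"
    unfolding W_def using X by (intro carrier_specht_hook2) auto
  also have "\<dots> = pm.span {alt3 X z x y | x y. x \<in> X \<and> y \<in> X}"
  proof (rule pm.span_eq[THEN iffD2], intro conjI subsetI)
    fix p assume "p \<in> {alt3 X a b c | a b c. a \<in> X \<and> b \<in> X \<and> c \<in> X}"
    then obtain a b c where p: "p = alt3 X z a b + alt3 X z b c + alt3 X z c a"
      and abc: "a \<in> X" "b \<in> X" "c \<in> X"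
      using alt3_cocycle by blast
    show "p \<in> pm.span {alt3 X z x y | x y. x \<in> X \<and> y \<in> X}"
      unfolding p using abc by (intro pm.span_add; intro pm.span_base) auto
  next
    fix p assume "p \<in> {alt3 X z x y | x y. x \<in> X \<and> y \<in> X}"
    then show "p \<in> pm.span {alt3 X a b c | a b c. a \<in> X \<and> b \<in> X \<and> c \<in> X}"
      using X(4) by (intro pm.span_base) blast
  qed
  finally show ?thesis .
qed

lemma V_subset: "v \<in> carrier V \<Longrightarrow> v \<in> pm.span (range (tab1 X))"
proof -
  have "D ` X \<subseteq> pm.span (range (tab1 X))"
    by (auto simp: D_def intro: pm.span_diff pm.span_base)
  then have "pm.span (D ` X) \<subseteq> pm.span (range (tab1 X))"
    by (intro pm.span_minimal) auto
  then show "v \<in> carrier V \<Longrightarrow> v \<in> pm.span (range (tab1 X))" by (auto simp: carrier_V)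
qed

section \<open>Relations of the exterior square and the two comparison maps\<close>

definition N where "N = pm.span (ext_square_relations V)"
definition C where "C = {p :: _ \<Rightarrow>\<^sub>0 complex. Poly_Mapping.keys p \<subseteq> carrier V \<times> carrier V}"
definition e where "e u v = Poly_Mapping.single (u :: nat set list \<Rightarrow>\<^sub>0 complex, v :: nat set list \<Rightarrow>\<^sub>0 complex) (1 :: complex)"

lemma subspace_N: "pm.subspace N" by (simp add: N_def)

lemma C_span: "C = pm.span {e u v | u v. u \<in> carrier V \<and> v \<in> carrier V}"
proof -
  have "(\<lambda>k. Poly_Mapping.single k (1::complex)) ` (carrier V \<times> carrier V) =
      {e u v | u v. u \<in> carrier V \<and> v \<in> carrier V}"
    by (auto simp: e_def)
  then show ?thesis unfolding C_def pm_keys_eq_span by simp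
qed

lemma N_rel:
  assumes "u \<in> carrier V" "v \<in> carrier V" "w \<in> carrier V"
  shows "e (u + v) w - e u w - e v w \<in> N" "e u (v + w) - e u v - e u w \<in> N"
    "e (pm_scale c v) w - pm_scale c (e v w) \<in> N" "e v (pm_scale c w) - pm_scale c (e v w) \<in> N"
    "e v v \<in> N"
  using ext_square_relationsI[OF V_simps(2,3) assms] unfolding N_def e_def by (auto intro: pm.span_base)

lemma N_zero:
  assumes "v \<in> carrier V"
  shows "e 0 v \<in> N" "e v 0 \<in> N"
  using N_rel(3)[OF assms assms assms, of 0] N_rel(4)[OF assms assms assms, of 0] by simp_all

lemma V_closed:
  "u \<in> carrier V \<Longrightarrow> v \<in> carrier V \<Longrightarrow> u + v \<in> carrier V" "u \<in> carrier V \<Longrightarrow> pm_scale c u \<in> carrier V"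
  "x \<in> X \<Longrightarrow> D x \<in> carrier V" "0 \<in> carrier V"
  by (auto simp: carrier_V pm.span_add pm.span_scale pm.span_zero intro: pm.span_base)

lemma N_swap:
  assumes "u \<in> carrier V" "v \<in> carrier V"
  shows "e u v + e v u \<in> N"
proof -
  note uv = V_closed(1)[OF assms]
  \<comment> \<open>Polarization: expand the square of \<open>u + v\<close> by bilinearity, one
    relation for each bracket.\<close>
  have "e u v + e v u = e (u + v) (u + v) - e u u - e v v
      - (e (u + v) (u + v) - e u (u + v) - e v (u + v))
      - (e u (u + v) - e u u - e u v) - (e v (u + v) - e v u - e v v)"
    by simp
  also have "\<dots> \<in> N"
    using assms uv by (intro pm.subspace_diff[OF subspace_N] N_rel)
  finally show ?thesis .
qed

definition F where "F = lin_ext (\<lambda>(u, v). wedge X u v)"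
text \<open>The weight \<open>1/2\<close> makes \<open>alt2 X x y\<close> go to half the difference
  of \<open>e (D x) (D y)\<close> and \<open>e (D y) (D x)\<close>, which is
  \<open>e (D x) (D y)\<close> modulo \<open>N\<close>.\<close>

definition G where "G = tab2_ext (\<lambda>x y. pm_scale (1/2) (e (D x) (D y)))"

lemma linear_F: "pm_linear F" and linear_G: "pm_linear G"
  by (simp_all add: F_def G_def linear_lin_ext linear_tab2_ext)

lemma F_e [simp]: "F (e u v) = wedge X u v"
  by (simp add: F_def e_def)

lemma F_N: "p \<in> N \<Longrightarrow> F p = 0"
proof -
  assume p: "p \<in> N"
  have "F p \<in> {0}"
  proof (rule pm_linear_in_subspace[OF linear_F])
    show "pm.subspace {0 :: nat set list \<Rightarrow>\<^sub>0 complex}" by (rule pm.subspace_single_0)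
    show "p \<in> pm.span (ext_square_relations V)" using p by (simp add: N_def)
    fix r assume r: "r \<in> ext_square_relations V"
    show "F r \<in> {0}"
      by (rule ext_square_relationsE[OF r V_simps(2,3)])
        (simp_all only: e_def[symmetric] F_e pm_linear_add[OF linear_F] pm_linear_diff[OF linear_F]
          pm_linear_scale[OF linear_F] wedge_linear_simps wedge_self, simp_all)
  qed
  then show ?thesis by simp
qed

text \<open>The wedge is a triangle with apex \<open>z\<close>. Its two edges through
  \<open>z\<close> are sent to symbols with an entry \<open>D z = 0\<close>, which lie in
  \<open>N\<close>; the third edge leaves the symmetric element handled by
  \<open>N_swap\<close>.\<close>

lemma e_D_minus_G:
  assumes "x \<in> X" "y \<in> X"
  shows "e (D x) (D y) - G (wedge X (D x) (D y)) \<in> N"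
proof -
  have z: "D z = 0" by (simp add: D_def)
  have "e (D x) (D y) - G (wedge X (D x) (D y)) = pm_scale (1/2)
      ((e (D x) (D y) + e (D y) (D x)) - e 0 (D x) + e (D x) 0 - e (D y) 0 + e 0 (D y))"
    unfolding D_def[of x] D_def[of y] wedge_diff
    unfolding D_def[symmetric] alt3_def pm_linear_add[OF linear_G]
    by (rule poly_mapping_eqI) (simp add: G_def lookup_add lookup_minus z field_simps)
  also have "\<dots> \<in> N"
    using assms V_closed
    by (intro pm.subspace_diff[OF subspace_N] pm.subspace_add[OF subspace_N]
        pm.subspace_scale[OF subspace_N] N_swap N_zero)
  finally show ?thesis .
qed

text \<open>The symbol \<open>e\<close> is bilinear only modulo \<open>N\<close>, so agreement on
  spanning vectors does not extend by linearity directly. Each induction over a span inserts the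
  defect of additivity and of homogeneity as explicit relations. Membership in
  \<open>carrier V\<close> is carried along because relations exist only for such vectors.\<close>

lemma e_minus_G:
  assumes "u \<in> carrier V" "v \<in> carrier V"
  shows "e u v - G (wedge X u v) \<in> N"
proof -
  note lin = wedge_linear_simps pm_linear_add[OF linear_G] pm_linear_scale[OF linear_G] pm_linear_0[OF linear_G]
  note N = pm.subspace_add[OF subspace_N] pm.subspace_scale[OF subspace_N]
  have right: "v \<in> carrier V \<and> e (D x) v - G (wedge X (D x) v) \<in> N" if x: "x \<in> X" for x
    using assms(2)[unfolded carrier_V]
  proof (induction rule: pm.span_induct_alt)
    case base
    show ?case using x by (simp add: lin N_zero V_closed)
  next
    case (step c v' w)
    then obtain y where y: "v' = D y" "y \<in> X" by blast
    have w: "w \<in> carrier V" and cw: "pm_scale c v' + w \<in> carrier V"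
      using step.IH y V_closed by auto
    have "e (D x) (pm_scale c v' + w) - G (wedge X (D x) (pm_scale c v' + w)) =
      (e (D x) (pm_scale c v' + w) - e (D x) (pm_scale c v') - e (D x) w) +
      (e (D x) (pm_scale c v') - pm_scale c (e (D x) v')) +
      pm_scale c (e (D x) v' - G (wedge X (D x) v')) + (e (D x) w - G (wedge X (D x) w))"
      by (simp add: lin pm.scale_right_diff_distrib)
    also have "\<dots> \<in> N"
      using step.IH e_D_minus_G[OF x y(2)] w x y V_closed by (intro N N_rel) auto
    finally show ?case using cw by blast
  qed
  have "u \<in> carrier V \<and> e u v - G (wedge X u v) \<in> N"
    using assms(1)[unfolded carrier_V]
  proof (induction rule: pm.span_induct_alt)
    case base
    show ?case using assms by (simp add: lin N_zero V_closed)
  next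
    case (step c u' w)
    then obtain y where y: "u' = D y" "y \<in> X" by blast
    have w: "w \<in> carrier V" and cw: "pm_scale c u' + w \<in> carrier V"
      using step.IH y V_closed by auto
    have "e (pm_scale c u' + w) v - G (wedge X (pm_scale c u' + w) v) =
      (e (pm_scale c u' + w) v - e (pm_scale c u') v - e w v) +
      (e (pm_scale c u') v - pm_scale c (e u' v)) +
      pm_scale c (e u' v - G (wedge X u' v)) + (e w v - G (wedge X w v))"
      by (simp add: lin pm.scale_right_diff_distrib)
    also have "\<dots> \<in> N"
      using step.IH right[OF y(2)] w y assms(2) V_closed by (intro N N_rel) auto
    finally show ?case using cw by blast
  qed
  then show ?thesis by simp
qed

section \<open>Equivariance of the comparison map\<close>

definition push :: "(nat \<Rightarrow> nat) \<Rightarrow>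
    ((nat set list \<Rightarrow>\<^sub>0 complex) \<times> (nat set list \<Rightarrow>\<^sub>0 complex) \<Rightarrow>\<^sub>0 complex) \<Rightarrow>
    ((nat set list \<Rightarrow>\<^sub>0 complex) \<times> (nat set list \<Rightarrow>\<^sub>0 complex) \<Rightarrow>\<^sub>0 complex)"
  where "push s = pm_push (map_prod (act V s) (act V s))"

lemma linear_push: "pm_linear (push s)"
  by (simp add: push_def linear_pm_push)

lemma push_e: "push s (e u v) = e (act V s u) (act V s v)"
  by (simp add: push_def e_def)

lemma act_closed_V: "s permutes X \<Longrightarrow> v \<in> carrier V \<Longrightarrow> act V s v \<in> carrier V"
  using representation.act_closed[OF repV, of s v] by (simp add: sym_group_on_def)

text \<open>The group acts on \<open>V\<close> by linear maps, so a relation of each of the five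
  kinds is sent to a relation of the same kind.\<close>

lemma push_N:
  assumes s: "s permutes X" and "p \<in> N"
  shows "push s p \<in> N"
proof (rule pm_linear_in_subspace[OF linear_push subspace_N])
  show "p \<in> pm.span (ext_square_relations V)" using assms(2) by (simp add: N_def)
  note lin = pm_linear_add[OF linear_push] pm_linear_diff[OF linear_push] pm_linear_scale[OF linear_push]
    pm_linear_add[OF linear_pm_push] pm_linear_scale[OF linear_pm_push]
  note act = act_closed_V[OF s]
  fix r assume r: "r \<in> ext_square_relations V"
  show "push s r \<in> N"
  proof (rule ext_square_relationsE[OF r V_simps(2,3), folded e_def])
    fix u v w assume uv: "u \<in> carrier V" "v \<in> carrier V" "w \<in> carrier V"
    note N = N_rel[OF uv[THEN act]]
    show "push s r \<in> N" if "r = e (u + v) w - e u w - e v w"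
      using N(1) by (simp add: that lin push_e V_simps(4))
    show "push s r \<in> N" if "r = e u (v + w) - e u v - e u w"
      using N(2) by (simp add: that lin push_e V_simps(4))
  next
    fix c v w assume uv: "v \<in> carrier V" "w \<in> carrier V"
    note N = N_rel[OF uv(1)[THEN act] uv[THEN act]]
    show "push s r \<in> N" if "r = e (pm_scale c v) w - pm_scale c (e v w)"
      using N(3) by (simp add: that lin push_e V_simps(4))
    show "push s r \<in> N" if "r = e v (pm_scale c w) - pm_scale c (e v w)"
      using N(4) by (simp add: that lin push_e V_simps(4))
  next
    fix v assume v: "v \<in> carrier V" "r = e v v"
    then show "push s r \<in> N"
      using N_rel(5)[OF v(1)[THEN act] v(1)[THEN act] v(1)[THEN act]] by (simp add: push_e)
  qed
qed

lemma push_C: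
  assumes s: "s permutes X" and p: "p \<in> C"
  shows "push s p \<in> C"
  unfolding C_span
proof (rule pm_linear_in_subspace[OF linear_push pm.subspace_span])
  show "p \<in> pm.span {e u v | u v. u \<in> carrier V \<and> v \<in> carrier V}"
    using p by (simp add: C_span)
  fix r assume "r \<in> {e u v | u v. u \<in> carrier V \<and> v \<in> carrier V}"
  then obtain u v where "r = e u v" "u \<in> carrier V" "v \<in> carrier V" by blast
  then show "push s r \<in> pm.span {e u v | u v. u \<in> carrier V \<and> v \<in> carrier V}"
    using act_closed_V[OF s] by (auto simp: push_e intro!: pm.span_base)
qed

lemma F_push:
  assumes s: "s permutes X" and p: "p \<in> C"
  shows "F (push s p) = pm_push (tabloid_act s) (F p)"
proof (rule pm_linear_eq_on_span[where f = "\<lambda>p. F (push s p)" and g = "\<lambda>p. pm_push (tabloid_act s) (F p)"])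
  show "pm_linear (\<lambda>p. F (push s p))" "pm_linear (\<lambda>p. pm_push (tabloid_act s) (F p))"
    by (rule pm_linear_compose[OF linear_push linear_F] pm_linear_compose[OF linear_F linear_pm_push])+
  show "p \<in> pm.span {e u v | u v. u \<in> carrier V \<and> v \<in> carrier V}"
    using p by (simp add: C_span)
  fix r assume "r \<in> {e u v | u v. u \<in> carrier V \<and> v \<in> carrier V}"
  then obtain u v where r: "r = e u v" and uv: "u \<in> carrier V" "v \<in> carrier V" by blast
  show "F (push s r) = pm_push (tabloid_act s) (F r)"
    unfolding r push_e F_e V_simps(4) by (rule push_wedge[OF s uv[THEN V_subset]])
qed

section \<open>Image and kernel of the comparison map\<close>

lemma wedge_in_W:
  assumes "u \<in> carrier V" "v \<in> carrier V"
  shows "wedge X u v \<in> carrier W"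
proof (rule pm_linear_in_subspace[OF linear_wedge_left, of _ "D ` X"])
  show "pm.subspace (carrier W)" by (simp add: carrier_W)
  show "u \<in> pm.span (D ` X)" using assms by (simp add: carrier_V)
  fix u' assume u': "u' \<in> D ` X"
  show "wedge X u' v \<in> carrier W"
  proof (rule pm_linear_in_subspace[OF linear_wedge_right, of _ "D ` X"])
    show "pm.subspace (carrier W)" by (simp add: carrier_W)
    show "v \<in> pm.span (D ` X)" using assms by (simp add: carrier_V)
    fix v' assume "v' \<in> D ` X"
    then obtain x y where "u' = D x" "v' = D y" "x \<in> X" "y \<in> X" using u' by blast
    then show "wedge X u' v' \<in> carrier W"
      by (auto simp: D_def wedge_diff carrier_W intro!: pm.span_base)
  qed
qed

lemma F_image: "F ` C = carrier W"
proof -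
  have "F ` C = pm.span (F ` {e u v | u v. u \<in> carrier V \<and> v \<in> carrier V})"
    unfolding C_span by (rule pm_linear_image_span[OF linear_F, symmetric])
  also have "F ` {e u v | u v. u \<in> carrier V \<and> v \<in> carrier V} =
      {F (e u v) | u v. u \<in> carrier V \<and> v \<in> carrier V}"
    by blast
  also have "\<dots> = {wedge X u v | u v. u \<in> carrier V \<and> v \<in> carrier V}"
    by (simp only: F_e)
  also have "pm.span \<dots> = carrier W"
  proof
    show "pm.span {wedge X u v | u v. u \<in> carrier V \<and> v \<in> carrier V} \<subseteq> carrier W"
      using wedge_in_W by (intro pm.span_minimal) (auto simp: carrier_W)
    have "alt3 X z x y \<in> {wedge X u v | u v. u \<in> carrier V \<and> v \<in> carrier V}"
      if "x \<in> X" "y \<in> X" for x y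
      using V_closed(3)[OF that(1)] V_closed(3)[OF that(2)] wedge_diff[of X x z y, folded D_def, symmetric] by blast
    then show "carrier W \<subseteq> pm.span {wedge X u v | u v. u \<in> carrier V \<and> v \<in> carrier V}"
      unfolding carrier_W by (intro pm.span_mono) blast
  qed
  finally show ?thesis .
qed

lemma F_eq_0_iff:
  assumes "p \<in> C"
  shows "F p = 0 \<longleftrightarrow> p \<in> N"
proof
  assume Fp: "F p = 0"
  have "p - G (F p) \<in> N"
  proof (rule pm_linear_in_subspace[OF _ subspace_N, where x = p])
    show "pm_linear (\<lambda>p. p - G (F p))"
      by (rule pm_linear_minus[OF pm_linear_id pm_linear_compose[OF linear_F linear_G]])
    show "p \<in> pm.span {e u v | u v. u \<in> carrier V \<and> v \<in> carrier V}"
      using assms by (simp add: C_span)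
  qed (auto simp: e_minus_G)
  then show "p \<in> N" by (simp add: Fp pm_linear_0[OF linear_G])
qed (rule F_N)

lemma ext_square_isomorphic: "rep_isomorphic (sym_group_on X) (ext_square V) W"
proof (rule rep_isomorphic_quotientI[OF repW subspace_N])
  show "pm.subspace C" by (simp add: C_span)
  show "carrier (ext_square V) = pm_coset N ` C"
    by (simp add: ext_square_simps(1) N_def C_def)
  show "\<zero>\<^bsub>ext_square V\<^esub> = N"
    "pm_coset N p \<oplus>\<^bsub>ext_square V\<^esub> pm_coset N q = pm_coset N (p + q)"
    "c \<odot>\<^bsub>ext_square V\<^esub> pm_coset N p = pm_coset N (pm_scale c p)" for c p q
    by (simp_all add: ext_square_simps(2-4) N_def)
  show "F ` C = carrier W" by (rule F_image)
  show "F p = \<zero>\<^bsub>W\<^esub> \<longleftrightarrow> p \<in> N" if "p \<in> C" for p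
    using F_eq_0_iff[OF that] by (simp add: W_def)
  show "F (p + q) = F p \<oplus>\<^bsub>W\<^esub> F q" "F (pm_scale c p) = c \<odot>\<^bsub>W\<^esub> F p" for c p q
    by (simp_all add: W_def pm_linear_add[OF linear_F] pm_linear_scale[OF linear_F])
  fix s p assume "s \<in> carrier (sym_group_on X)" and p: "p \<in> C"
  then have s: "s permutes X" by (simp add: sym_group_on_def)
  have "act (ext_square V) s (pm_coset N p) = pm_coset N (push s p)"
    unfolding ext_square_simps(5) N_def[symmetric] push_def[symmetric]
    by (rule quot_map_pm_coset)
      (simp_all add: free_module_def subspace_N pm_linear_add[OF linear_push] push_N[OF s])
  then show "\<exists>q\<in>C. act (ext_square V) s (pm_coset N p) = pm_coset N q \<and> F q = act W s (F p)"
    using push_C[OF s p] F_push[OF s p] by (auto simp: W_def)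
qed

end

section \<open>The degree one part of the cohomology algebra\<close>

lemma pm_add_induct:
  fixes p :: "'a \<Rightarrow>\<^sub>0 complex"
  assumes "\<And>k c. P (Poly_Mapping.single k c)" "\<And>p q. P p \<Longrightarrow> P q \<Longrightarrow> P (p + q)"
  shows "P p"
proof -
  \<comment> \<open>The empty sum is covered by the first hypothesis with coefficient 0.\<close>
  have "P (\<Sum>k\<in>A. pm_scale (Poly_Mapping.lookup p k) (Poly_Mapping.single k 1))" if "finite A" for A
    using that by induction (use assms assms(1)[of undefined 0] in auto)
  then show ?thesis by (subst pm_decompose) simp
qed

lemma pm_scale_mult_left: "pm_scale c p * q = pm_scale c (p * q :: 'a::monoid_add \<Rightarrow>\<^sub>0 complex)"
proof (induction p rule: pm_add_induct)
  case (1 k a)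
  show ?case
    by (induction q rule: pm_add_induct) (simp_all add: mult_single distrib_left pm.scale_right_distrib mult_ac)
qed (simp add: pm.scale_right_distrib distrib_right)

text \<open>Scalars are constants of the free algebra; hence every ideal of it is a linear
  subspace.\<close>

lemma pm_scale_eq_mult: "pm_scale c p = Poly_Mapping.single 0 c * (p :: 'a::monoid_add \<Rightarrow>\<^sub>0 complex)"
  using pm_scale_mult_left[of c "Poly_Mapping.single 0 1" p] by (simp only: pm_scale_single) simp

lemma letters_zero [simp]: "letters 0 = []"
  by (simp add: zero_word_def)

lemma letters_plus [simp]: "letters (v + w) = letters v @ letters w"
  by (simp add: plus_word_def)

lemma letters_eq_Nil_iff [simp]: "letters w = [] \<longleftrightarrow> w = 0"
  by (cases w) (simp add: zero_word_def)

lemma plus_word_eq_0_iff [simp]: "v + w = 0 \<longleftrightarrow> v = 0 \<and> w = (0 :: 'a word)"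
  by (simp flip: letters_eq_Nil_iff)

lemma map_word_zero [simp]: "map_word f 0 = 0"
  by (simp add: zero_word_def)

lemma map_word_plus [simp]: "map_word f (v + w) = map_word f v + map_word f w"
  by (cases v; cases w) (simp add: plus_word_def)

text \<open>A concatenation is empty only if both words are, so the constant term is
  multiplicative.\<close>

lemma lookup_mult_zero:
  "Poly_Mapping.lookup (p * q) (0 :: 'a word) = (Poly_Mapping.lookup p 0 * Poly_Mapping.lookup q 0 :: complex)"
proof (induction p rule: pm_add_induct)
  case (1 k a)
  show ?case
    by (induction q rule: pm_add_induct)
      (auto simp: mult_single lookup_single when_def distrib_left lookup_add)
qed (simp add: lookup_add distrib_right)

lemma push_word_mult:
  "pm_push (map_word f) (p * q) = pm_push (map_word f) p * pm_push (map_word f) q"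
proof (induction p rule: pm_add_induct)
  case (1 k a)
  show ?case
    by (induction q rule: pm_add_induct)
      (simp_all add: mult_single distrib_left pm_linear_add[OF linear_pm_push])
qed (simp add: pm_linear_add[OF linear_pm_push] distrib_right)

text \<open>Words of length other than one are sent to 0, so the map depends only on the linear part
  of its argument.\<close>

definition deg1_ext :: "(nat \<Rightarrow> nat \<Rightarrow> ('b \<Rightarrow>\<^sub>0 complex)) \<Rightarrow> free_alg \<Rightarrow> ('b \<Rightarrow>\<^sub>0 complex)"
  where "deg1_ext h = lin_ext (\<lambda>w. case letters w of [(i, j)] \<Rightarrow> h i j | _ \<Rightarrow> 0)"

lemma linear_deg1_ext: "pm_linear (deg1_ext h)"
  by (simp add: deg1_ext_def linear_lin_ext)

lemma deg1_ext_gen [simp]: "deg1_ext h (gen i j) = h i j"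
  by (simp add: deg1_ext_def gen_def)

lemma lookup_gen_0 [simp]: "Poly_Mapping.lookup (gen i j) 0 = 0"
  by (simp add: gen_def lookup_single when_def zero_word_def)

text \<open>A word of length one splits only as itself and the empty word. Thus the linear part
  obeys a Leibniz rule with respect to the constant term.\<close>

lemma deg1_ext_mult:
  "deg1_ext h (p * q) =
    pm_scale (Poly_Mapping.lookup p 0) (deg1_ext h q) + pm_scale (Poly_Mapping.lookup q 0) (deg1_ext h p)"
proof (induction p rule: pm_add_induct)
  case (1 v a)
  show ?case
  proof (induction q rule: pm_add_induct)
    case (1 w b)
    have [simp]: "Poly_Mapping.lookup (Poly_Mapping.single u (c :: complex)) (0 :: (nat \<times> nat) word) =
        (if letters u = [] then c else 0)" for u c
      by (simp add: lookup_single when_def)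
    show ?case
      unfolding mult_single deg1_ext_def lin_ext_single
      by (cases "letters v"; cases "letters w") (auto split: list.splits simp: mult_ac simp del: letters_eq_Nil_iff)
  next
    case (2 p q)
    then show ?case
      by (simp add: distrib_left lookup_add pm_linear_add[OF linear_deg1_ext]
          pm.scale_left_distrib pm.scale_right_distrib algebra_simps)
  qed
next
  case (2 p q)
  then show ?case
    by (simp add: distrib_right lookup_add pm_linear_add[OF linear_deg1_ext]
        pm.scale_left_distrib pm.scale_right_distrib algebra_simps)
qed

section \<open>The free algebra as a ring and the ideal of relations\<close>

definition conf_words :: "nat \<Rightarrow> (nat \<times> nat) word set"
  where "conf_words n = {w. set (letters w) \<subseteq> {1..n} \<times> {1..n}}"

lemma free_ring_simps [simp]:
  "monoid.mult (free_ring n) = (*)" "one (free_ring n) = 1" "zero (free_ring n) = 0" "add (free_ring n) = (+)"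
  by (simp_all add: free_ring_def)

lemma carrier_free_ring: "carrier (free_ring n) = {p. Poly_Mapping.keys p \<subseteq> conf_words n}"
  by (auto simp: free_ring_def conf_words_def)

lemma carrier_free_ring_span:
  "carrier (free_ring n) = pm.span ((\<lambda>w. Poly_Mapping.single w 1) ` conf_words n)"
  by (simp only: carrier_free_ring pm_keys_eq_span)

lemma subspace_free_ring: "pm.subspace (carrier (free_ring n))"
  by (simp add: carrier_free_ring_span)

lemma free_ring_closed:
  assumes "p \<in> carrier (free_ring n)" "q \<in> carrier (free_ring n)"
  shows "p + q \<in> carrier (free_ring n)" "- p \<in> carrier (free_ring n)" "p - q \<in> carrier (free_ring n)"
    "p * q \<in> carrier (free_ring n)"
proof -
  show "p + q \<in> carrier (free_ring n)" "- p \<in> carrier (free_ring n)" "p - q \<in> carrier (free_ring n)"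
    using assms by (simp_all add: carrier_free_ring_span pm.span_add pm.span_neg pm.span_diff)
  show "p * q \<in> carrier (free_ring n)"
    using assms keys_mult[of p q] by (fastforce simp: carrier_free_ring conf_words_def)
qed

lemma one_free_ring: "Poly_Mapping.single 0 c \<in> carrier (free_ring n)"
  by (auto simp: carrier_free_ring conf_words_def)

lemma gen_in_free_ring: "i \<in> {1..n} \<Longrightarrow> j \<in> {1..n} \<Longrightarrow> gen i j \<in> carrier (free_ring n)"
  by (auto simp: gen_def carrier_free_ring conf_words_def)

lemma ring_free_ring: "ring (free_ring n)"
proof (rule ringI)
  show "abelian_group (free_ring n)"
  proof (rule abelian_groupI)
    show "\<exists>q\<in>carrier (free_ring n). q \<oplus>\<^bsub>free_ring n\<^esub> p = \<zero>\<^bsub>free_ring n\<^esub>"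
      if "p \<in> carrier (free_ring n)" for p
      using free_ring_closed(2)[OF that that] by (intro bexI[of _ "- p"]) simp_all
  qed (simp_all add: free_ring_closed pm.subspace_0[OF subspace_free_ring] add_ac)
  show "Group.monoid (free_ring n)"
    using one_free_ring[of 1 n] by (intro monoidI) (simp_all add: free_ring_closed mult.assoc)
qed (simp_all add: distrib_left distrib_right)

locale conf =
  fixes n d :: nat
  assumes d: "odd d" "d \<ge> 3" and n: "n \<ge> 2"
begin

abbreviation R where "R \<equiv> free_ring n"
definition I where "I = rel_ideal n d"

lemma relations_eq: "relations n d =
    {gen i i | i. i \<in> {1..n}} \<union>
    {gen i j + gen j i | i j. i \<in> {1..n} \<and> j \<in> {1..n}} \<union>
    {gen i j * gen h k - gen h k * gen i j | i j h k.
      i \<in> {1..n} \<and> j \<in> {1..n} \<and> h \<in> {1..n} \<and> k \<in> {1..n}} \<union>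
    {gen i j * gen i k - gen k j * (gen i k - gen i j) | i j k.
      i \<in> {1..n} \<and> j \<in> {1..n} \<and> k \<in> {1..n} \<and> j \<le> k}"
  using d by (simp add: relations_def)

lemma relationsE:
  assumes "r \<in> relations n d"
  obtains i where "r = gen i i" "i \<in> {1..n}"
  | i j where "r = gen i j + gen j i" "i \<in> {1..n}" "j \<in> {1..n}"
  | i j h k where "r = gen i j * gen h k - gen h k * gen i j"
      "i \<in> {1..n}" "j \<in> {1..n}" "h \<in> {1..n}" "k \<in> {1..n}"
  | i j k where "r = gen i j * gen i k - gen k j * (gen i k - gen i j)"
      "i \<in> {1..n}" "j \<in> {1..n}" "k \<in> {1..n}" "j \<le> k"
  using assms unfolding relations_eq
  apply (elim UnE CollectE exE conjE)
  subgoal for i by (rule that(1)[of i])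
  subgoal for i j by (rule that(2)[of i j])
  subgoal for i j h k by (rule that(3)[of i j h k])
  subgoal for i j k by (rule that(4)[of i j k])
  done

lemma relationsI:
  assumes "i \<in> {1..n}" "j \<in> {1..n}" "h \<in> {1..n}" "k \<in> {1..n}"
  shows "gen i i \<in> relations n d" "gen i j + gen j i \<in> relations n d"
    "gen i j * gen h k - gen h k * gen i j \<in> relations n d"
    "j \<le> k \<Longrightarrow> gen i j * gen i k - gen k j * (gen i k - gen i j) \<in> relations n d"
  unfolding relations_eq
  by (rule UnI1, rule UnI1, rule UnI1, use assms in blast)
    (rule UnI1, rule UnI1, rule UnI2, use assms in blast,
     rule UnI1, rule UnI2, use assms in blast, rule UnI2, use assms in blast)

lemma relations_subset: "relations n d \<subseteq> carrier R"
proof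
  fix r assume "r \<in> relations n d"
  then show "r \<in> carrier R"
    by (cases rule: relationsE) (simp_all only: free_ring_closed gen_in_free_ring)
qed

lemma ideal_I: "ideal I R"
  unfolding I_def rel_ideal_def by (rule ring.genideal_ideal[OF ring_free_ring relations_subset])

lemma relations_in_I: "relations n d \<subseteq> I"
  unfolding I_def rel_ideal_def by (rule ring.genideal_self[OF ring_free_ring relations_subset])

lemma I_minimal: "ideal J R \<Longrightarrow> relations n d \<subseteq> J \<Longrightarrow> I \<subseteq> J"
  unfolding I_def rel_ideal_def by (rule ring.genideal_minimal[OF ring_free_ring])

lemma subspace_I: "pm.subspace I"
  unfolding pm.subspace_def
proof (intro conjI ballI allI)
  show "0 \<in> I"
    using additive_subgroup.zero_closed[OF ideal.axioms(1)[OF ideal_I]] by simp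
  show "p + q \<in> I" if "p \<in> I" "q \<in> I" for p q
    using additive_subgroup.a_closed[OF ideal.axioms(1)[OF ideal_I] that] by simp
  show "pm_scale c p \<in> I" if "p \<in> I" for c p
    using ideal.I_l_closed[OF ideal_I that one_free_ring[of c]] by (simp add: pm_scale_eq_mult)
qed

lemma gen_in_I:
  assumes "i \<in> {1..n}" "j \<in> {1..n}"
  shows "gen i i \<in> I" "gen i j + gen j i \<in> I"
  using relationsI[OF assms assms] relations_in_I by blast+

lemma idealI':
  assumes J: "pm.subspace J" "J \<subseteq> carrier R"
    and mult: "\<And>p q. p \<in> J \<Longrightarrow> q \<in> carrier R \<Longrightarrow> q * p \<in> J \<and> p * q \<in> J"
  shows "ideal J R"
proof (rule idealI[OF ring_free_ring])
  interpret R: ring R by (rule ring_free_ring)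
  show "subgroup J (add_monoid R)"
  proof (rule R.add.subgroupI)
    show "\<ominus>\<^bsub>R\<^esub> p \<in> J" if "p \<in> J" for p
    proof -
      have "\<ominus>\<^bsub>R\<^esub> p = - p"
        using J(2) that free_ring_closed(2) by (intro R.minus_equality) auto
      then show ?thesis using pm.subspace_neg[OF J(1) that] by simp
    qed
  qed (use J in \<open>auto simp: pm.subspace_add dest: pm.subspace_0\<close>)
qed (use mult in auto)

text \<open>The linear part of a product of two elements without constant term vanishes.\<close>

lemma deg1_ext_I:
  assumes h: "\<And>i j. h i j = - h j i" and "p \<in> I"
  shows "deg1_ext h p = 0"
proof -
  \<comment> \<open>The vanishing constant term belongs to the definition because of the Leibniz
    rule: otherwise multiplying by \<open>q\<close> would contribute the constant term of
    \<open>p\<close> times the linear part of \<open>q\<close>.\<close>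
  let ?J = "{p \<in> carrier R. Poly_Mapping.lookup p 0 = 0 \<and> deg1_ext h p = 0}"
  note lin = pm_linear_add[OF linear_deg1_ext] pm_linear_diff[OF linear_deg1_ext]
    pm_linear_scale[OF linear_deg1_ext] pm_linear_0[OF linear_deg1_ext]
  have hii: "h i i = 0" for i
  proof (rule poly_mapping_eqI)
    fix k
    have "Poly_Mapping.lookup (h i i) k = - Poly_Mapping.lookup (h i i) k"
      by (subst h) simp
    then show "Poly_Mapping.lookup (h i i) k = Poly_Mapping.lookup 0 k" by simp
  qed
  have hsym: "h i j + h j i = 0" for i j
    by (subst h) simp
  have "ideal ?J R"
  proof (rule idealI')
    show "pm.subspace ?J"
      using subspace_free_ring[of n] by (auto simp: pm.subspace_def lookup_add lin)
    show "q * p \<in> ?J \<and> p * q \<in> ?J" if "p \<in> ?J" "q \<in> carrier R" for p q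
      using that by (simp add: free_ring_closed lookup_mult_zero deg1_ext_mult)
  qed auto
  moreover have "relations n d \<subseteq> ?J"
  proof
    fix r assume r: "r \<in> relations n d"
    then have "r \<in> carrier R" using relations_subset by blast
    moreover have "Poly_Mapping.lookup r 0 = 0 \<and> deg1_ext h r = 0"
      using r by (cases rule: relationsE)
        (simp_all add: lookup_add lookup_minus lookup_mult_zero deg1_ext_mult lin hii hsym)
    ultimately show "r \<in> ?J" by simp
  qed
  ultimately have "I \<subseteq> ?J" by (rule I_minimal)
  then show ?thesis using assms(2) by blast
qed

section \<open>Representatives in degree \<open>d - 1\<close> and operations on cosets\<close>

definition C1 where "C1 = pm.span {gen i j | i j. i \<in> {1..n} \<and> j \<in> {1..n}}"

lemma subspace_C1: "pm.subspace C1" by (simp add: C1_def)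

lemma gen_in_C1: "i \<in> {1..n} \<Longrightarrow> j \<in> {1..n} \<Longrightarrow> gen i j \<in> C1"
  unfolding C1_def by (rule pm.span_base) blast

text \<open>The span form suits arguments on generators; the form by word length matches the
  definition of the graded pieces.\<close>

lemma C1_eq: "C1 = {p \<in> carrier R. \<forall>w\<in>Poly_Mapping.keys p. length (letters w) = 1}"
proof -
  let ?W = "{w \<in> conf_words n. length (letters w) = 1}"
  have "?W = {Word [(i, j)] | i j. i \<in> {1..n} \<and> j \<in> {1..n}}"
  proof (intro equalityI subsetI)
    fix w assume "w \<in> ?W"
    then obtain x where "letters w = [x]" "x \<in> {1..n} \<times> {1..n}"
      by (auto simp: conf_words_def length_Suc_conv)
    then show "w \<in> {Word [(i, j)] | i j. i \<in> {1..n} \<and> j \<in> {1..n}}"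
      by (cases w; cases x) auto
  qed (auto simp: conf_words_def)
  then have "(\<lambda>w. Poly_Mapping.single w 1) ` ?W = {gen i j | i j. i \<in> {1..n} \<and> j \<in> {1..n}}"
    by (auto simp: gen_def)
  then have "C1 = {p. Poly_Mapping.keys p \<subseteq> ?W}"
    unfolding C1_def pm_keys_eq_span by simp
  then show ?thesis by (auto simp: carrier_free_ring)
qed

lemma C1_subset: "C1 \<subseteq> carrier R"
  by (auto simp: C1_eq)

abbreviation H where "H \<equiv> conf_cohomology n d"

lemma H_simps:
  "carrier H = pm_coset I ` carrier R" "\<zero>\<^bsub>H\<^esub> = I"
  "pm_coset I p \<oplus>\<^bsub>H\<^esub> pm_coset I q = pm_coset I (p + q)"
  "c \<odot>\<^bsub>H\<^esub> pm_coset I p = pm_coset I (pm_scale c p)"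
proof -
  note defs = conf_cohomology_def ring.defs module.defs FactRing_def I_def[symmetric]
  have [simp]: "I +>\<^bsub>R\<^esub> p = pm_coset I p" for p
    by (simp add: a_r_coset_eq_pm_coset)
  show "carrier H = pm_coset I ` carrier R" "\<zero>\<^bsub>H\<^esub> = I"
    by (auto simp: defs A_RCOSETS_def')
  show "pm_coset I p \<oplus>\<^bsub>H\<^esub> pm_coset I q = pm_coset I (p + q)"
    using set_add_pm_coset[OF _ subspace_I, of R] by (simp add: defs)
  show "c \<odot>\<^bsub>H\<^esub> pm_coset I p = pm_coset I (pm_scale c p)"
    using quot_map_pm_coset[OF _ subspace_I, of R "pm_scale c"] pm.subspace_scale[OF subspace_I]
    by (simp add: defs pm.scale_right_distrib)
qed

lemma coset_in_H: "p \<in> carrier R \<Longrightarrow> pm_coset I p \<in> carrier H"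
  unfolding H_simps(1) by (rule image_eqI[OF refl])

lemma H_left_neg: "pm_coset I (- p) \<oplus>\<^bsub>H\<^esub> pm_coset I p = \<zero>\<^bsub>H\<^esub>"
  unfolding H_simps by simp

text \<open>Needed to evaluate the subtractions and negatives in the prescribed values of
  \<open>(0 1)\<close> on cosets.\<close>

lemma abelian_group_H: "abelian_group H"
proof (rule abelian_groupI)
  note closed = free_ring_closed pm.subspace_0[OF subspace_free_ring]
  fix x assume "x \<in> carrier H"
  then obtain p where p: "p \<in> carrier R" "x = pm_coset I p" by (auto simp: H_simps)
  show "\<exists>y\<in>carrier H. y \<oplus>\<^bsub>H\<^esub> x = \<zero>\<^bsub>H\<^esub>"
    unfolding p(2) using H_left_neg coset_in_H[OF free_ring_closed(2)[OF p(1) p(1)]] by blast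
  show "\<zero>\<^bsub>H\<^esub> \<oplus>\<^bsub>H\<^esub> x = x"
    using H_simps(3)[of 0 p] by (simp add: p H_simps(2))
  fix y assume "y \<in> carrier H"
  then obtain q where q: "q \<in> carrier R" "y = pm_coset I q" by (auto simp: H_simps)
  show "x \<oplus>\<^bsub>H\<^esub> y \<in> carrier H"
    unfolding p q H_simps using closed(1)[OF p(1) q(1)] by blast
  show "x \<oplus>\<^bsub>H\<^esub> y = y \<oplus>\<^bsub>H\<^esub> x"
    unfolding p q H_simps by (simp add: add.commute)
  fix z assume "z \<in> carrier H"
  then obtain r where r: "r \<in> carrier R" "z = pm_coset I r" by (auto simp: H_simps)
  show "x \<oplus>\<^bsub>H\<^esub> y \<oplus>\<^bsub>H\<^esub> z = x \<oplus>\<^bsub>H\<^esub> (y \<oplus>\<^bsub>H\<^esub> z)"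
    unfolding p q r H_simps by (simp add: add.assoc)
next
  show "\<zero>\<^bsub>H\<^esub> \<in> carrier H"
    using pm.subspace_0[OF subspace_free_ring[of n]] unfolding H_simps by (intro image_eqI[of _ _ 0]) simp_all
qed

lemma H_minus:
  assumes "p \<in> carrier R" "q \<in> carrier R"
  shows "\<ominus>\<^bsub>H\<^esub> pm_coset I p = pm_coset I (- p)"
    "pm_coset I p \<ominus>\<^bsub>H\<^esub> pm_coset I q = pm_coset I (p - q)"
proof -
  interpret H: abelian_group H by (rule abelian_group_H)
  have neg: "\<ominus>\<^bsub>H\<^esub> pm_coset I p = pm_coset I (- p)" if p: "p \<in> carrier R" for p
    by (intro H.minus_equality H_left_neg coset_in_H free_ring_closed(2)[OF p p] p)
  show "\<ominus>\<^bsub>H\<^esub> pm_coset I p = pm_coset I (- p)" using neg assms by blast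
  show "pm_coset I p \<ominus>\<^bsub>H\<^esub> pm_coset I q = pm_coset I (p - q)"
    unfolding a_minus_def neg[OF assms(2)] H_simps by simp
qed

lemma conf_class_eq: "conf_class n d i j = pm_coset I (gen i j)"
  by (simp add: conf_class_def I_def a_r_coset_eq_pm_coset)

lemma deg1_eq: "conf_cohomology_deg n d (d - 1) = pm_coset I ` C1"
proof -
  have "(d - 1) * l = d - 1 \<longleftrightarrow> l = 1" for l
    using d by auto
  then show ?thesis
    by (auto simp: conf_cohomology_deg_def C1_eq I_def[symmetric] a_r_coset_eq_pm_coset)
qed

lemma rep_simps:
  "carrier (conf_cohomology_rep n d (d - 1) \<rho>) = pm_coset I ` C1"
  "\<zero>\<^bsub>conf_cohomology_rep n d (d - 1) \<rho>\<^esub> = I"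
  "pm_coset I p \<oplus>\<^bsub>conf_cohomology_rep n d (d - 1) \<rho>\<^esub> pm_coset I q = pm_coset I (p + q)"
  "c \<odot>\<^bsub>conf_cohomology_rep n d (d - 1) \<rho>\<^esub> pm_coset I p = pm_coset I (pm_scale c p)"
  "act (conf_cohomology_rep n d (d - 1) \<rho>) = \<rho>"
  using H_simps(2-4) by (simp_all add: conf_cohomology_rep_def module.defs rep.defs deg1_eq del: One_nat_def)

section \<open>The natural action on representatives\<close>

definition push where "push s = pm_push (map_word (map_prod s s :: nat \<times> nat \<Rightarrow> _))"

lemma linear_push: "pm_linear (push s)"
  by (simp add: push_def linear_pm_push)

lemma push_gen: "push s (gen i j) = gen (s i) (s j)"
  by (simp add: push_def gen_def)

lemma push_mult: "push s (p * q) = push s p * push s q"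
  by (simp add: push_def push_word_mult)

lemma push_carrier:
  assumes s: "s permutes {1..n}" and p: "p \<in> carrier R"
  shows "push s p \<in> carrier R"
proof (rule pm_linear_in_subspace[OF linear_push subspace_free_ring])
  show "p \<in> pm.span ((\<lambda>w. Poly_Mapping.single w 1) ` conf_words n)"
    using p by (simp add: carrier_free_ring_span)
  fix r assume "r \<in> (\<lambda>w. Poly_Mapping.single w (1::complex)) ` conf_words n"
  then obtain w where w: "r = Poly_Mapping.single w 1" "w \<in> conf_words n" by blast
  have "letters (map_word (map_prod s s) w) = map (map_prod s s) (letters w)"
    by (cases w) simp
  then have "map_word (map_prod s s) w \<in> conf_words n"
    using w(2) permutes_in_image[OF s] by (fastforce simp: conf_words_def)
  then show "push s r \<in> carrier R"
    by (simp add: w(1) push_def carrier_free_ring)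
qed

lemma push_C1:
  assumes s: "s permutes {1..n}" and p: "p \<in> C1"
  shows "push s p \<in> C1"
proof (rule pm_linear_in_subspace[OF linear_push subspace_C1])
  show "p \<in> pm.span {gen i j | i j. i \<in> {1..n} \<and> j \<in> {1..n}}" using p by (simp add: C1_def)
  fix r assume "r \<in> {gen i j | i j. i \<in> {1..n} \<and> j \<in> {1..n}}"
  then obtain i j where ij: "r = gen i j" "i \<in> {1..n}" "j \<in> {1..n}" by blast
  then show "push s r \<in> C1"
    using permutes_in_image[OF s] by (simp only: push_gen gen_in_C1)
qed

lemma push_relation:
  assumes s: "s permutes {1..n}" and r: "r \<in> relations n d"
  shows "push s r \<in> I"
  using r
proof (cases rule: relationsE)
  note s' = permutes_in_image[OF s, THEN iffD2]
  note lin = pm_linear_add[OF linear_push] pm_linear_diff[OF linear_push]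
  {
    case (1 i)
    then show ?thesis using gen_in_I(1) s' by (simp only: push_gen)
  next
    case (2 i j)
    then show ?thesis using gen_in_I(2) s' by (simp only: push_gen lin)
  next
    case (3 i j h k)
    note s'[OF 3(2)] s'[OF 3(3)] s'[OF 3(4)] s'[OF 3(5)]
    then have "push s r \<in> relations n d"
      unfolding 3(1) push_gen lin push_mult by (rule relationsI(3))
    then show ?thesis using relations_in_I by blast
  next
    case (4 i j k)
    note ijk = s'[OF 4(2)] s'[OF 4(3)] s'[OF 4(4)]
    have eq: "push s r = gen (s i) (s j) * gen (s i) (s k) - gen (s k) (s j) * (gen (s i) (s k) - gen (s i) (s j))"
      (is "_ = ?x * ?y - ?u * (?y - ?x)")
      unfolding 4(1) push_gen lin push_mult ..
    show ?thesis
    proof (cases "s j \<le> s k")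
      case True
      with ijk have "push s r \<in> relations n d"
        unfolding eq by (intro relationsI(4))
      then show ?thesis using relations_in_I by blast
    next
      case False
      \<comment> \<open>The permutation has reversed the order of the two indices, so the result is
        not itself a listed relation. It is the relation with the indices exchanged, corrected by a
        commutator and by a multiple of \<open>?v + ?u\<close>, which lies in the ideal by
        antisymmetry.\<close>
      let ?v = "gen (s j) (s k)"
      have "?y * ?x - ?v * (?x - ?y) \<in> I" "?x * ?y - ?y * ?x \<in> I"
        using ijk False by (intro subsetD[OF relations_in_I] relationsI; simp)+
      moreover have "(?v + ?u) * (?x - ?y) \<in> I"
        using ideal.I_r_closed[OF ideal_I gen_in_I(2)[OF ijk(2,3)] free_ring_closed(3)[OF
            gen_in_free_ring[OF ijk(1,2)] gen_in_free_ring[OF ijk(1,3)]]] by simp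
      moreover have "push s r = (?y * ?x - ?v * (?x - ?y)) + (?x * ?y - ?y * ?x) + (?v + ?u) * (?x - ?y)"
        unfolding eq by (simp add: algebra_simps)
      ultimately show ?thesis
        by (simp only: pm.subspace_add[OF subspace_I])
    qed
  }
qed

text \<open>\<open>push s\<close> is multiplicative, so the preimage of \<open>I\<close> is an
  ideal; it contains the relations, hence all of \<open>I\<close>.\<close>

lemma push_I:
  assumes s: "s permutes {1..n}" and p: "p \<in> I"
  shows "push s p \<in> I"
proof -
  let ?J = "{p \<in> carrier R. push s p \<in> I}"
  note lin = pm_linear_add[OF linear_push] pm_linear_scale[OF linear_push] pm_linear_0[OF linear_push]
  have "ideal ?J R"
  proof (rule idealI')
    show "pm.subspace ?J"
      using subspace_free_ring[of n] subspace_I by (auto simp: pm.subspace_def lin)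
    show "q * p \<in> ?J \<and> p * q \<in> ?J" if "p \<in> ?J" "q \<in> carrier R" for p q
      using that ideal.I_l_closed[OF ideal_I, of "push s p" "push s q"]
        ideal.I_r_closed[OF ideal_I, of "push s p" "push s q"] push_carrier[OF s]
      by (simp add: free_ring_closed push_mult)
  qed auto
  moreover have "relations n d \<subseteq> ?J"
    using relations_subset push_relation[OF s] by blast
  ultimately show ?thesis using I_minimal p by blast
qed

lemma natural_act_coset:
  assumes "s permutes {1..n}"
  shows "natural_act n d s (pm_coset I p) = pm_coset I (push s p)"
  unfolding natural_act_def I_def[symmetric] push_def[symmetric]
  by (rule quot_map_pm_coset)
    (simp_all add: subspace_I pm_linear_add[OF linear_push] push_I[OF assms])

end

section \<open>The extended action in degree \<open>d - 1\<close>\<close>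

context conf
begin

text \<open>The class of \<open>gen i j\<close> corresponds to \<open>(e_i - e_0)\<close> wedge
  \<open>(e_j - e_0)\<close>. The stabilizer of 0 permutes these like the generators, while
  \<open>(0 1)\<close> moves the base point; re-expressing the result with base point 0 produces the
  correction terms.\<close>

lemma extended_isomorphic:
  assumes "extended_action n d \<rho>"
  shows "rep_isomorphic (sym_group_on {0..n}) (conf_cohomology_rep n d (d - 1) \<rho>)
    (specht {0..n} [n - 1, 1, 1])"
proof -
  let ?X = "{0..n}"
  interpret S: pointed_set ?X "n - 1" 0
    by unfold_locales (use n in auto)
  let ?h = "alt3 ?X 0"
  let ?F = "deg1_ext ?h"
  \<comment> \<open>No generator carries the index 0, so tabloids involving 0 are sent to 0; for a
    triangle with apex 0 only the opposite edge contributes.\<close>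
  let ?G = "tab2_ext (\<lambda>x y. if x = 0 \<or> y = 0 then 0 else pm_scale (1/2) (gen x y))"
  let ?tau = "\<lambda>s. pm_push (tabloid_act s)"
  note lin_F = pm_linear_add[OF linear_deg1_ext[of ?h]] pm_linear_diff[OF linear_deg1_ext[of ?h]]
    pm_linear_scale[OF linear_deg1_ext[of ?h]] pm_linear_0[OF linear_deg1_ext[of ?h]]
    pm_linear_neg[OF linear_deg1_ext[of ?h]]
  have F_I: "?F p = 0" if "p \<in> I" for p
    by (rule deg1_ext_I[OF _ that]) (rule alt3_swap)
  have F_cong: "?F p = ?F q" if "p - q \<in> I" for p q
    using F_I[OF that] by (simp add: lin_F)
  have \<rho>: "\<And>s. s permutes ?X \<Longrightarrow> graded_automorphism n d (\<rho> s)"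
    "\<And>s t x. s permutes ?X \<Longrightarrow> t permutes ?X \<Longrightarrow> x \<in> carrier H \<Longrightarrow> \<rho> (s \<circ> t) x = \<rho> s (\<rho> t x)"
    "\<And>s x. s permutes {1..n} \<Longrightarrow> x \<in> carrier H \<Longrightarrow> \<rho> s x = natural_act n d s x"
    "\<And>i j. 1 < i \<Longrightarrow> i < j \<Longrightarrow> j \<le> n \<Longrightarrow> \<rho> (transpose 0 1) (conf_class n d i j) =
      conf_class n d i j \<ominus>\<^bsub>H\<^esub> conf_class n d 1 j \<oplus>\<^bsub>H\<^esub> conf_class n d 1 i"
    "\<And>j. 1 < j \<Longrightarrow> j \<le> n \<Longrightarrow> \<rho> (transpose 0 1) (conf_class n d 1 j) = \<ominus>\<^bsub>H\<^esub> conf_class n d 1 j"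
    using assms unfolding extended_action_def Let_def by simp_all
  have \<rho>_add: "\<rho> s (pm_coset I (p + q)) = \<rho> s (pm_coset I p) \<oplus>\<^bsub>H\<^esub> \<rho> s (pm_coset I q)"
    if "s permutes ?X" "p \<in> carrier R" "q \<in> carrier R" for s p q
  proof -
    have "\<rho> s \<in> ring_hom H H"
      using \<rho>(1)[OF that(1)] by (simp add: graded_automorphism_def Let_def ring_iso_def)
    from ring_hom_add[OF this coset_in_H[OF that(2)] coset_in_H[OF that(3)]]
    show ?thesis by (simp only: H_simps(3))
  qed
  have \<rho>_scale: "\<rho> s (pm_coset I (pm_scale c p)) = c \<odot>\<^bsub>H\<^esub> \<rho> s (pm_coset I p)"
    if "s permutes ?X" "p \<in> carrier R" for s c p
  proof -
    have "\<rho> s (c \<odot>\<^bsub>H\<^esub> x) = c \<odot>\<^bsub>H\<^esub> \<rho> s x" if "x \<in> carrier H" for x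
      using \<rho>(1)[OF \<open>s permutes ?X\<close>] that by (simp add: graded_automorphism_def Let_def)
    from this[OF coset_in_H[OF that(2)]] show ?thesis by (simp only: H_simps(4))
  qed
  \<comment> \<open>\<open>Q s\<close> collects the representatives on which \<open>\<rho> s\<close>
    stays in degree \<open>d - 1\<close> and is intertwined by \<open>?F\<close>. The inclusion of
    \<open>C1\<close> in \<open>Q s\<close> is preserved by composition, so it only has to be
    verified for the stabilizer of 0 and for \<open>(0 1)\<close>.\<close>
  define Q where "Q s = {p \<in> C1. \<exists>q\<in>C1. \<rho> s (pm_coset I p) = pm_coset I q \<and> ?F q = ?tau s (?F p)}" for s
  have subspace_Q: "pm.subspace (Q s)" if s: "s permutes ?X" for s
    unfolding pm.subspace_def
  proof (intro conjI ballI allI)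
    note tau = pm_linear_add[OF linear_pm_push] pm_linear_scale[OF linear_pm_push]
    show "p + p' \<in> Q s" if p: "p \<in> Q s" "p' \<in> Q s" for p p'
    proof -
      obtain q q' where q: "p \<in> C1" "q \<in> C1" "\<rho> s (pm_coset I p) = pm_coset I q" "?F q = ?tau s (?F p)"
        and q': "p' \<in> C1" "q' \<in> C1" "\<rho> s (pm_coset I p') = pm_coset I q'" "?F q' = ?tau s (?F p')"
        using p unfolding Q_def by blast
      have "\<rho> s (pm_coset I (p + p')) = pm_coset I (q + q')"
        using \<rho>_add[OF s subsetD[OF C1_subset q(1)] subsetD[OF C1_subset q'(1)]]
        unfolding q(3) q'(3) H_simps(3) .
      moreover have "?F (q + q') = ?tau s (?F (p + p'))"
        using q(4) q'(4) by (simp add: lin_F tau)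
      ultimately show ?thesis
        using q(1,2) q'(1,2) pm.subspace_add[OF subspace_C1] unfolding Q_def by blast
    qed
    have scale: "pm_scale c p \<in> Q s" if p: "p \<in> C1" "q \<in> C1" "\<rho> s (pm_coset I p) = pm_coset I q"
      "?F q = ?tau s (?F p)" for c p q
    proof -
      have "\<rho> s (pm_coset I (pm_scale c p)) = pm_coset I (pm_scale c q)"
        using \<rho>_scale[OF s subsetD[OF C1_subset p(1)]] unfolding p(3) H_simps(4) .
      moreover have "?F (pm_scale c q) = ?tau s (?F (pm_scale c p))"
        using p(4) by (simp add: lin_F tau)
      ultimately show ?thesis
        using p(1,2) pm.subspace_scale[OF subspace_C1] unfolding Q_def by blast
    qed
    show "pm_scale c p \<in> Q s" if "p \<in> Q s" for c p
      using that scale unfolding Q_def by blast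
    have "0 \<in> C1" using pm.subspace_0[OF subspace_C1] .
    moreover have "\<rho> s (pm_coset I 0) = pm_coset I 0"
    proof -
      have "\<rho> s (pm_coset I 0) \<in> carrier H"
        using \<rho>(1)[OF s] coset_in_H[OF pm.subspace_0[OF subspace_free_ring]]
        unfolding graded_automorphism_def Let_def by (auto simp only: ring_iso_def dest: ring_hom_closed)
      then obtain q where "\<rho> s (pm_coset I 0) = pm_coset I q" unfolding H_simps(1) by blast
      then show ?thesis
        using \<rho>_scale[OF s pm.subspace_0[OF subspace_free_ring], of 0]
        unfolding pm.scale_zero_left by (simp only: H_simps(4) pm.scale_zero_left)
    qed
    moreover have "?F 0 = ?tau s (?F 0)"
      by (simp add: lin_F pm_linear_0[OF linear_pm_push])
    ultimately show "0 \<in> Q s" unfolding Q_def by blast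
  qed
  \<comment> \<open>Membership depends only on the class modulo \<open>I\<close>. This extends the
    values of \<open>(0 1)\<close>, prescribed only for increasing indices, to all pairs.\<close>
  have Q_cong: "p \<in> Q s" if "q \<in> Q s" "p \<in> C1" "p - q \<in> I" for s p q
  proof -
    have "pm_coset I p = pm_coset I q" using that pm_coset_eq_iff[OF subspace_I] by blast
    then show ?thesis using that F_cong[OF that(3)] unfolding Q_def by auto
  qed
  have Q_all: "C1 \<subseteq> Q s" if "s permutes ?X" "\<And>i j. i \<in> {1..n} \<Longrightarrow> j \<in> {1..n} \<Longrightarrow> gen i j \<in> Q s" for s
    using subspace_Q[OF that(1)] that(2) unfolding C1_def by (intro pm.span_minimal) auto
  have Q_natural: "C1 \<subseteq> Q s" if s: "s permutes {1..n}" for s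
  proof -
    have sX: "s permutes ?X" by (rule permutes_subset[OF s]) auto
    have s0: "s 0 = 0" by (rule permutes_not_in[OF s]) simp
    show ?thesis
    proof (rule Q_all[OF sX])
      fix i j assume ij: "i \<in> {1..n}" "j \<in> {1..n}"
      have "\<rho> s (pm_coset I (gen i j)) = pm_coset I (gen (s i) (s j))"
        using \<rho>(3)[OF s coset_in_H[OF gen_in_free_ring[OF ij]]]
        unfolding natural_act_coset[OF s] push_gen .
      moreover have "gen (s i) (s j) \<in> C1"
        using ij permutes_in_image[OF s] by (intro gen_in_C1) auto
      moreover have "?F (gen (s i) (s j)) = ?tau s (?F (gen i j))"
        by (simp add: push_alt3[OF sX] s0)
      ultimately show "gen i j \<in> Q s"
        using gen_in_C1[OF ij] unfolding Q_def by blast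
    qed
  qed
  let ?t = "transpose 0 (1 :: nat)"
  have t: "?t permutes ?X" by (rule permutes_swap_id) (use n in auto)
  have Q_less: "gen i j \<in> Q ?t" if ij: "i \<in> {1..n}" "j \<in> {1..n}" "i < j" for i j
  proof (cases "i = 1")
    case True
    have "\<rho> ?t (pm_coset I (gen i j)) = pm_coset I (- gen i j)"
      using \<rho>(5)[of j] ij True H_minus(1)[OF gen_in_free_ring[OF ij(1,2)] gen_in_free_ring[OF ij(1,2)]]
      by (simp add: conf_class_eq)
    moreover have "- gen i j \<in> C1" by (rule pm.subspace_neg[OF subspace_C1 gen_in_C1[OF ij(1,2)]])
    moreover have "?F (- gen i j) = ?tau ?t (?F (gen i j))"
      using ij True by (simp add: lin_F push_alt3[OF t] alt3_swap(1)[of ?X 1 0 j] del: One_nat_def)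
    ultimately show ?thesis using gen_in_C1[OF ij(1,2)] unfolding Q_def by blast
  next
    case False
    have one: "1 \<in> {1..n}" using n by simp
    note g = gen_in_free_ring[OF ij(1,2)] gen_in_free_ring[OF one ij(2)] gen_in_free_ring[OF one ij(1)]
    have "\<rho> ?t (pm_coset I (gen i j)) = pm_coset I (gen i j - gen 1 j + gen 1 i)"
      using \<rho>(4)[of i j] ij False
      unfolding conf_class_eq H_minus(2)[OF g(1,2)] H_simps(3) by simp
    moreover have "gen i j - gen 1 j + gen 1 i \<in> C1"
      by (intro pm.subspace_add[OF subspace_C1] pm.subspace_diff[OF subspace_C1] gen_in_C1 ij one)
    moreover have "?F (gen i j - gen 1 j + gen 1 i) = ?tau ?t (?F (gen i j))"
      using ij False alt3_cocycle[of ?X 1 i j 0] alt3_swap(2)[of ?X 0 j 1]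
      by (simp add: lin_F push_alt3[OF t] del: One_nat_def)
    ultimately show ?thesis using gen_in_C1[OF ij(1,2)] unfolding Q_def by blast
  qed
  have Q_t: "C1 \<subseteq> Q ?t"
  proof (rule Q_all[OF t])
    fix i j assume ij: "i \<in> {1..n}" "j \<in> {1..n}"
    consider "i < j" | "i = j" | "j < i" by linarith
    then show "gen i j \<in> Q ?t"
    proof cases
      case 2
      then show ?thesis
        using gen_in_C1[OF ij] gen_in_I(1)[OF ij] pm.subspace_0[OF subspace_Q[OF t]]
        by - (rule Q_cong[where q = 0], auto)
    next
      case 3
      then show ?thesis
        using gen_in_C1[OF ij] gen_in_I(2)[OF ij] pm.subspace_neg[OF subspace_Q[OF t] Q_less[OF ij(2,1)]]
        by - (rule Q_cong[where q = "- gen j i"], auto)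
    qed (use Q_less ij in blast)
  qed
  have Q_comp: "C1 \<subseteq> Q (s \<circ> s')" if s: "s permutes ?X" "s' permutes ?X" "C1 \<subseteq> Q s" "C1 \<subseteq> Q s'" for s s'
  proof
    fix p assume p: "p \<in> C1"
    then obtain q where q: "q \<in> C1" "\<rho> s' (pm_coset I p) = pm_coset I q" "?F q = ?tau s' (?F p)"
      using s(4) unfolding Q_def by blast
    then obtain r where r: "r \<in> C1" "\<rho> s (pm_coset I q) = pm_coset I r" "?F r = ?tau s (?F q)"
      using s(3) unfolding Q_def by blast
    have "tabloid_act (s \<circ> s') = tabloid_act s \<circ> tabloid_act s'"
      by (auto simp: tabloid_act_def fun_eq_iff image_image)
    then have "?F r = ?tau (s \<circ> s') (?F p)"
      using q(3) r(3) by (simp add: pm_push_compose)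
    moreover have "\<rho> (s \<circ> s') (pm_coset I p) = pm_coset I r"
      using \<rho>(2)[OF s(1,2) coset_in_H[OF subsetD[OF C1_subset p]]] q(2) r(2) by simp
    ultimately show "p \<in> Q (s \<circ> s')" using p r(1) unfolding Q_def by blast
  qed
  have Q: "C1 \<subseteq> Q s" if s: "s permutes ?X" for s
  proof (cases "s 0 = 0")
    case True
    have "s permutes {1..n}"
    proof (rule permutes_superset[OF s])
      fix x assume "x \<in> ?X - {1..n}"
      then have "x = 0" by auto
      then show "s x = x" using True by simp
    qed
    then show ?thesis by (rule Q_natural)
  next
    case False
    \<comment> \<open>With this choice \<open>?t \<circ> u \<circ> s\<close> sends 0 to
      \<open>s 0\<close>, then to 1, then back to 0, so it lies in the stabilizer of 0. As
      \<open>u\<close> and \<open>?t\<close> are involutions, \<open>s\<close> is recovered by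
      composing with them again; \<open>u\<close> fixes 0 because \<open>s 0\<close> is not
      0.\<close>
    define u where "u = transpose 1 (s 0)"
    have "s 0 \<in> ?X" using permutes_in_image[OF s] by simp
    then have u: "u permutes {1..n}"
      unfolding u_def using False n by (intro permutes_swap_id) auto
    have uX: "u permutes ?X" by (rule permutes_subset[OF u]) auto
    have v: "?t \<circ> u \<circ> s permutes ?X"
      using s uX t by (intro permutes_compose)
    have "?t \<circ> u \<circ> s permutes {1..n}"
    proof (rule permutes_superset[OF v])
      fix x assume "x \<in> ?X - {1..n}"
      then have "x = 0" by auto
      then show "(?t \<circ> u \<circ> s) x = x" by (simp add: u_def)
    qed
    from Q_comp[OF permutes_compose[OF t uX] v Q_comp[OF uX t Q_natural[OF u] Q_t] Q_natural[OF this]]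
    have "C1 \<subseteq> Q (u \<circ> ?t \<circ> (?t \<circ> u \<circ> s))" .
    also have "u \<circ> ?t \<circ> (?t \<circ> u \<circ> s) = s"
      by (simp add: fun_eq_iff u_def)
    finally show ?thesis .
  qed
  have F_image: "?F ` C1 = carrier S.W"
  proof -
    have "?F ` C1 = pm.span (?F ` {gen i j | i j. i \<in> {1..n} \<and> j \<in> {1..n}})"
      unfolding C1_def by (rule pm_linear_image_span[OF linear_deg1_ext, symmetric])
    also have "?F ` {gen i j | i j. i \<in> {1..n} \<and> j \<in> {1..n}} =
        {?F (gen i j) | i j. i \<in> {1..n} \<and> j \<in> {1..n}}" by blast
    also have "\<dots> = {?h i j | i j. i \<in> {1..n} \<and> j \<in> {1..n}}"
      by (simp only: deg1_ext_gen)
    \<comment> \<open>The additional indices 0 only add triangles with a repeated vertex, which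
      vanish.\<close>
    also have "pm.span \<dots> = pm.span {?h i j | i j. i \<in> ?X \<and> j \<in> ?X}"
    proof (rule pm.span_eq[THEN iffD2], intro conjI subsetI)
      fix p assume "p \<in> {?h i j | i j. i \<in> ?X \<and> j \<in> ?X}"
      then obtain i j where ij: "p = ?h i j" "i \<in> ?X" "j \<in> ?X" by blast
      show "p \<in> pm.span {?h i j | i j. i \<in> {1..n} \<and> j \<in> {1..n}}"
      proof (cases "i = 0 \<or> j = 0")
        case True
        then show ?thesis using ij(1) by (auto simp: pm.span_zero)
      next
        case False
        then have "i \<in> {1..n}" "j \<in> {1..n}" using ij by auto
        then show ?thesis using ij(1) by (intro pm.span_base) blast
      qed
    next
      fix p assume "p \<in> {?h i j | i j. i \<in> {1..n} \<and> j \<in> {1..n}}"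
      then obtain i j where "p = ?h i j" "i \<in> {1..n}" "j \<in> {1..n}" by blast
      then have "p = ?h i j" "i \<in> ?X" "j \<in> ?X" by auto
      then show "p \<in> pm.span {?h i j | i j. i \<in> ?X \<and> j \<in> ?X}"
        by (intro pm.span_base) blast
    qed
    also have "\<dots> = carrier S.W" by (rule S.carrier_W[symmetric])
    finally show ?thesis .
  qed
  have F_0: "?F p = 0 \<longleftrightarrow> p \<in> I" if p: "p \<in> C1" for p
  proof
    assume "?F p = 0"
    have "p - ?G (?F p) \<in> I"
    proof (rule pm_linear_in_subspace[OF _ subspace_I, where f = "\<lambda>p. p - ?G (?F p)"])
      show "pm_linear (\<lambda>p. p - ?G (?F p))"
        by (rule pm_linear_minus[OF pm_linear_id pm_linear_compose[OF linear_deg1_ext linear_tab2_ext]])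
      show "p \<in> pm.span {gen i j | i j. i \<in> {1..n} \<and> j \<in> {1..n}}" using p by (simp add: C1_def)
      fix r assume "r \<in> {gen i j | i j. i \<in> {1..n} \<and> j \<in> {1..n}}"
      then obtain i j where r: "r = gen i j" and ij: "i \<in> {1..n}" "j \<in> {1..n}" by blast
      have "r - ?G (?F r) = pm_scale (1/2) (gen i j + gen j i)"
        unfolding r deg1_ext_gen alt3_def pm_linear_add[OF linear_tab2_ext]
        using ij by (intro poly_mapping_eqI) (simp add: lookup_add lookup_minus field_simps)
      then show "r - ?G (?F r) \<in> I"
        using gen_in_I(2)[OF ij] pm.subspace_scale[OF subspace_I] by simp
    qed
    then show "p \<in> I" using \<open>?F p = 0\<close> by (simp add: pm_linear_0[OF linear_tab2_ext])
  qed (rule F_I)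
  have "rep_isomorphic (sym_group_on ?X) (conf_cohomology_rep n d (d - 1) \<rho>) S.W"
  proof (rule rep_isomorphic_quotientI[OF S.repW subspace_I subspace_C1 rep_simps(1,2,3,4) F_image])
    show "?F p = \<zero>\<^bsub>S.W\<^esub> \<longleftrightarrow> p \<in> I" if "p \<in> C1" for p
      using F_0[OF that] by (simp add: S.W_def del: One_nat_def)
    show "?F (p + q) = ?F p \<oplus>\<^bsub>S.W\<^esub> ?F q" "?F (pm_scale c p) = c \<odot>\<^bsub>S.W\<^esub> ?F p" for c p q
      by (simp_all add: S.W_def lin_F del: One_nat_def)
    fix s p assume s: "s \<in> carrier (sym_group_on ?X)" and p: "p \<in> C1"
    then have "p \<in> Q s" using Q by (auto simp: sym_group_on_def)
    then show "\<exists>q\<in>C1. act (conf_cohomology_rep n d (d - 1) \<rho>) s (pm_coset I p) = pm_coset I q \<and>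
        ?F q = act S.W s (?F p)"
      unfolding rep_simps(5) S.W_def specht_simps Q_def by blast
  qed
  then show ?thesis by (simp only: S.W_def)
qed

end

section \<open>Direct sums and the natural action in degree \<open>d - 1\<close>\<close>

lemma representation_direct_sum:
  assumes V: "representation G V" and W: "representation G W"
  shows "representation G (direct_sum_rep V W)"
proof -
  interpret V: representation G V by fact
  interpret W: representation G W by fact
  note defs = direct_sum_rep_def
  have "abelian_group (direct_sum_rep V W)"
  proof (rule abelian_groupI)
    fix x assume "x \<in> carrier (direct_sum_rep V W)"
    then obtain v w where vw: "x = (v, w)" "v \<in> carrier V" "w \<in> carrier W" by (auto simp: defs)
    then show "\<exists>y\<in>carrier (direct_sum_rep V W). y \<oplus>\<^bsub>direct_sum_rep V W\<^esub> x = \<zero>\<^bsub>direct_sum_rep V W\<^esub>"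
      by (intro bexI[of _ "(\<ominus>\<^bsub>V\<^esub> v, \<ominus>\<^bsub>W\<^esub> w)"]) (auto simp: defs V.V.l_neg W.V.l_neg)
  qed (auto simp: defs V.V.a_ac W.V.a_ac)
  then show ?thesis
    using V.group_axioms
    by (intro representationI)
      (auto simp: defs V.V.smult_l_distr V.V.smult_r_distr V.V.smult_assoc1[simplified]
        W.V.smult_l_distr W.V.smult_r_distr W.V.smult_assoc1[simplified]
        V.V.smult_l_distr[simplified] W.V.smult_l_distr[simplified]
        V.V.smult_one[simplified] W.V.smult_one[simplified]
        V.V.smult_closed[simplified] W.V.smult_closed[simplified]
        V.act_closed V.act_add V.act_smult V.act_one V.act_mult
        W.act_closed W.act_add W.act_smult W.act_one W.act_mult)
qed

context conf
begin

text \<open>A vector is its own average over \<open>n\<close> indices; in this form the normalising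
  factors of the inverse map are absorbed.\<close>

lemma pm_scale_sum_const: "pm_scale (1 / of_nat n) (\<Sum>k\<in>{1..n}. p) = p"
  using n by (intro poly_mapping_eqI) (simp add: lookup_sum)


text \<open>
  The components are the contraction \<open>e\<^sub>i \<and> e\<^sub>j \<mapsto> e\<^sub>i - e\<^sub>j\<close> and \<open>n\<close> times the projection
  \<open>e\<^sub>i \<and> e\<^sub>j \<mapsto> (e\<^sub>i - m) \<and> (e\<^sub>j - m)\<close> along the mean \<open>m\<close> of the basis.
\<close>

lemma natural_isomorphic:
  "rep_isomorphic (sym_group n) (conf_cohomology_rep n d (d - 1) (natural_act n d))
    (direct_sum_rep (specht {1..n} [n - 1, 1])
      (if n = 2 then zero_rep else specht {1..n} [n - 2, 1, 1]))"
proof -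
  let ?X = "{1..n}"
  define A where "A = specht ?X [n - 1, 1]"
  define B :: "(nat \<Rightarrow> nat, nat set list \<Rightarrow>\<^sub>0 complex) rep"
    where "B = (if n = 2 then zero_rep else specht ?X [n - 2, 1, 1])"
  let ?SA = "{tab1 ?X b - tab1 ?X a | a b. a \<in> ?X \<and> b \<in> ?X}"
  let ?SB = "{alt3 ?X a b c | a b c. a \<in> ?X \<and> b \<in> ?X \<and> c \<in> ?X}"
  let ?SC = "{gen i j | i j. i \<in> ?X \<and> j \<in> ?X}"
  have G: "sym_group n = sym_group_on ?X"
    by (simp add: sym_group_def sym_group_on_def)
  have cA: "carrier A = pm.span ?SA"
    unfolding A_def using n by (intro carrier_specht_hook1) auto
  have repA: "representation (sym_group_on ?X) A"
    unfolding A_def using n by (intro representation_specht_hook1) auto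
  have cB: "carrier B = pm.span ?SB"
  proof (cases "n = 2")
    case True
    \<comment> \<open>Among three elements of a two-element set two coincide, so all triangles
      vanish. Hence the description of \<open>carrier B\<close> as a span of triangles holds for
      \<open>n = 2\<close> as well, and the rest needs no case distinction.\<close>
    have "p = 0" if p: "p \<in> ?SB" for p
    proof -
      obtain a b c where abc: "p = alt3 ?X a b c" "a \<in> ?X" "b \<in> ?X" "c \<in> ?X" using p by blast
      then have "a = b \<or> b = c \<or> a = c" using True by auto
      then show ?thesis using abc(1) by auto
    qed
    then have "pm.span ?SB \<subseteq> {0}" by (intro pm.span_minimal) auto
    then show ?thesis using True pm.span_zero by (auto simp: B_def zero_rep_def)
  next
    case False
    then have "carrier (specht ?X [n - 2, 1, 1]) = pm.span ?SB"
      using n by (intro carrier_specht_hook2) auto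
    then show ?thesis by (simp only: B_def False if_False)
  qed
  have B_simps: "\<zero>\<^bsub>B\<^esub> = 0" "add B = (+)"
    "\<And>c v. v \<in> carrier B \<Longrightarrow> c \<odot>\<^bsub>B\<^esub> v = pm_scale c v"
    "\<And>s v. v \<in> carrier B \<Longrightarrow> act B s v = pm_push (tabloid_act s) v"
    by (auto simp: B_def zero_rep_def pm_linear_0[OF linear_pm_push])
  have repB: "representation (sym_group_on ?X) B"
    by (rule representation_push[OF cB B_simps push_alt3_in])
  let ?hA = "\<lambda>i j. tab1 ?X i - tab1 ?X j" and ?hB = "\<lambda>i j. \<Sum>k\<in>?X. alt3 ?X i j k"
  let ?FA = "deg1_ext ?hA" and ?FB = "deg1_ext ?hB"
  \<comment> \<open>On a difference of two basis vectors the terms \<open>e_k\<close> of the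
    contractions cancel, and \<open>n\<close> equal summands remain; the factor
    \<open>1 / of_nat n\<close> compensates for them.\<close>
  let ?GA = "tab1_ext (\<lambda>x. pm_scale (1 / of_nat n) (\<Sum>k\<in>?X. gen x k))"
  \<comment> \<open>The factor 2 accounts for the two orders of a pair, the factor \<open>n\<close>
    for the sum over \<open>k\<close> in \<open>?hB\<close>.\<close>
  let ?GB = "tab2_ext (\<lambda>x y. pm_scale (1 / of_nat (2 * n)) (gen x y))"
  let ?F = "\<lambda>p. (?FA p, ?FB p)" and ?G = "\<lambda>u v. ?GA u + ?GB v"
  note lin_FA = pm_linear_add[OF linear_deg1_ext[of ?hA]] pm_linear_diff[OF linear_deg1_ext[of ?hA]]
    pm_linear_scale[OF linear_deg1_ext[of ?hA]] pm_linear_sum[OF linear_deg1_ext[of ?hA]]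
  note lin_FB = pm_linear_add[OF linear_deg1_ext[of ?hB]] pm_linear_diff[OF linear_deg1_ext[of ?hB]]
    pm_linear_scale[OF linear_deg1_ext[of ?hB]] pm_linear_sum[OF linear_deg1_ext[of ?hB]]
  note lin_GA = pm_linear_add[OF linear_tab1_ext] pm_linear_diff[OF linear_tab1_ext]
    pm_linear_0[OF linear_tab1_ext]
  note lin_GB = pm_linear_add[OF linear_tab2_ext] pm_linear_diff[OF linear_tab2_ext]
    pm_linear_0[OF linear_tab2_ext] pm_linear_sum[OF linear_tab2_ext]
  have hB_swap: "?hB i j = - ?hB j i" for i j
    unfolding sum_negf[symmetric] by (rule sum.cong[OF refl alt3_swap(1)])
  have F_I: "?FA p = 0" "?FB p = 0" if "p \<in> I" for p
    by (rule deg1_ext_I[OF _ that], simp) (rule deg1_ext_I[OF _ that], rule hB_swap)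
  have GA_SA: "?GA (tab1 ?X b - tab1 ?X a) = pm_scale (1 / of_nat n) (\<Sum>k\<in>?X. gen b k - gen a k)" for a b
    by (simp add: lin_GA sum_subtractf pm.scale_right_diff_distrib)
  have GB_SB: "?GB (alt3 ?X a b c) = pm_scale (1 / of_nat (2 * n))
      ((gen a b - gen b a) + (gen b c - gen c b) + (gen c a - gen a c))" for a b c
    by (simp add: alt3_def lin_GB pm.scale_right_diff_distrib pm.scale_right_distrib)
  note n_scale = pm_scale_sum_const
  \<comment> \<open>The double sum of \<open>alt3\<close> over its last two arguments changes sign
    when they are exchanged. This gives \<open>FB_GA\<close>: the image of \<open>?GA\<close> has no
    component in \<open>B\<close>.\<close>
  have hB_sum: "(\<Sum>k\<in>?X. ?hB a k) = 0" for a
  proof (rule poly_mapping_eqI)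
    fix T
    have "(\<Sum>k\<in>?X. ?hB a k) = (\<Sum>k\<in>?X. \<Sum>l\<in>?X. alt3 ?X a l k)"
      by (rule sum.swap)
    also have "\<dots> = - (\<Sum>k\<in>?X. ?hB a k)"
      unfolding sum_negf[symmetric] by (intro sum.cong refl alt3_swap(2))
    finally have "Poly_Mapping.lookup (\<Sum>k\<in>?X. ?hB a k) T = - Poly_Mapping.lookup (\<Sum>k\<in>?X. ?hB a k) T"
      by (metis lookup_uminus)
    then show "Poly_Mapping.lookup (\<Sum>k\<in>?X. ?hB a k) T = Poly_Mapping.lookup 0 T" by simp
  qed
  have FA_GA: "?FA (?GA u) = u" if "u \<in> carrier A" for u
  proof (rule pm_linear_eq_on_span[OF _ _ _ that[unfolded cA], where g = "\<lambda>u. u" and f = "\<lambda>u. ?FA (?GA u)"])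
    fix r assume "r \<in> ?SA"
    then obtain a b where r: "r = tab1 ?X b - tab1 ?X a" by blast
    show "?FA (?GA r) = r"
      unfolding r GA_SA lin_FA deg1_ext_gen by (simp add: n_scale del: One_nat_def)
  qed (rule pm_linear_compose[OF linear_tab1_ext linear_deg1_ext] pm_linear_id)+
  have FB_GA: "?FB (?GA u) = 0" if "u \<in> carrier A" for u
  proof (rule pm_linear_eq_on_span[OF _ _ _ that[unfolded cA], where g = "\<lambda>u. 0" and f = "\<lambda>u. ?FB (?GA u)"])
    fix r assume "r \<in> ?SA"
    then obtain a b where r: "r = tab1 ?X b - tab1 ?X a" by blast
    show "?FB (?GA r) = 0"
      unfolding r GA_SA lin_FB deg1_ext_gen by (simp only: sum_subtractf hB_sum) simp
  qed (rule pm_linear_compose[OF linear_tab1_ext linear_deg1_ext], rule pm_linearI, simp_all)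
  have FA_GB: "?FA (?GB v) = 0" if "v \<in> carrier B" for v
  proof (rule pm_linear_eq_on_span[OF _ _ _ that[unfolded cB], where g = "\<lambda>u. 0" and f = "\<lambda>u. ?FA (?GB u)"])
    fix r assume "r \<in> ?SB"
    then obtain a b c where r: "r = alt3 ?X a b c" by blast
    show "?FA (?GB r) = 0"
      unfolding r GB_SB lin_FA deg1_ext_gen by simp
  qed (rule pm_linear_compose[OF linear_tab2_ext linear_deg1_ext], rule pm_linearI, simp_all)
  have FB_GB: "?FB (?GB v) = v" if "v \<in> carrier B" for v
  proof (rule pm_linear_eq_on_span[OF _ _ _ that[unfolded cB], where g = "\<lambda>u. u" and f = "\<lambda>u. ?FB (?GB u)"])
    fix r assume "r \<in> ?SB"
    then obtain a b c where r: "r = alt3 ?X a b c" by blast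
    have "?FB (?GB r) = pm_scale (1 / of_nat (2 * n))
        ((?hB a b - ?hB b a) + (?hB b c - ?hB c b) + (?hB c a - ?hB a c))"
      unfolding r GB_SB lin_FB deg1_ext_gen ..
    also have "\<dots> = pm_scale (1 / of_nat n) (?hB a b + ?hB b c + ?hB c a)"
      unfolding hB_swap[of b a] hB_swap[of c b] hB_swap[of a c]
      using n by (intro poly_mapping_eqI) (simp add: lookup_add field_simps)
    also have "\<dots> = pm_scale (1 / of_nat n) (\<Sum>k\<in>?X. alt3 ?X a b k + alt3 ?X b c k + alt3 ?X c a k)"
      by (simp add: sum.distrib)
    also have "(\<lambda>k. alt3 ?X a b k + alt3 ?X b c k + alt3 ?X c a k) = (\<lambda>k. alt3 ?X a b c)"
    proof
      fix k
      \<comment> \<open>After a cyclic rotation the three summands are the triangles with apex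
        \<open>k\<close>, and the cocycle identity makes their sum independent of
        \<open>k\<close>.\<close>
      have cyc: "alt3 ?X x y k = alt3 ?X k x y" for x y by (simp add: alt3_def)
      show "alt3 ?X a b k + alt3 ?X b c k + alt3 ?X c a k = alt3 ?X a b c"
        unfolding cyc by (rule alt3_cocycle[symmetric])
    qed
    finally show "?FB (?GB r) = r" by (simp add: r n_scale del: One_nat_def)
  qed (rule pm_linear_compose[OF linear_tab2_ext linear_deg1_ext] pm_linear_id)+
  have FA_in: "?FA p \<in> carrier A" if "p \<in> C1" for p
    unfolding cA
  proof (rule pm_linear_in_subspace[OF linear_deg1_ext pm.subspace_span _ that[unfolded C1_def]])
    fix r assume "r \<in> ?SC"
    then obtain i j where r: "r = gen i j" "i \<in> ?X" "j \<in> ?X" by blast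
    show "?FA r \<in> pm.span ?SA"
      unfolding r deg1_ext_gen using r(2,3) by (intro pm.span_base) blast
  qed
  have FB_in: "?FB p \<in> carrier B" if "p \<in> C1" for p
    unfolding cB
  proof (rule pm_linear_in_subspace[OF linear_deg1_ext pm.subspace_span _ that[unfolded C1_def]])
    fix r assume "r \<in> ?SC"
    then obtain i j where r: "r = gen i j" "i \<in> ?X" "j \<in> ?X" by blast
    show "?FB r \<in> pm.span ?SB"
      unfolding r deg1_ext_gen using r(2,3) by (intro pm.span_sum pm.span_base) blast
  qed
  have GA_in: "?GA u \<in> C1" if "u \<in> carrier A" for u
  proof (rule pm_linear_in_subspace[OF linear_tab1_ext subspace_C1 _ that[unfolded cA]])
    fix r assume "r \<in> ?SA"
    then obtain a b where r: "r = tab1 ?X b - tab1 ?X a" "a \<in> ?X" "b \<in> ?X" by blast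
    show "?GA r \<in> C1"
      unfolding r GA_SA using r(2,3)
      by (intro pm.subspace_scale[OF subspace_C1] pm.subspace_sum[OF subspace_C1]
          pm.subspace_diff[OF subspace_C1] gen_in_C1)
  qed
  have GB_in: "?GB v \<in> C1" if "v \<in> carrier B" for v
  proof (rule pm_linear_in_subspace[OF linear_tab2_ext subspace_C1 _ that[unfolded cB]])
    fix r assume "r \<in> ?SB"
    then obtain a b c where r: "r = alt3 ?X a b c" "a \<in> ?X" "b \<in> ?X" "c \<in> ?X" by blast
    show "?GB r \<in> C1"
      unfolding r GB_SB using r(2-4)
      by (intro pm.subspace_scale[OF subspace_C1] pm.subspace_add[OF subspace_C1]
          pm.subspace_diff[OF subspace_C1] gen_in_C1)
  qed
  have F_image: "?F ` C1 = carrier (direct_sum_rep A B)"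
  proof (intro equalityI subsetI)
    fix x assume "x \<in> carrier (direct_sum_rep A B)"
    then obtain u v where x: "x = (u, v)" "u \<in> carrier A" "v \<in> carrier B"
      by (auto simp: direct_sum_rep_def)
    have "x = ?F (?G u v)"
      by (simp only: x(1) lin_FA lin_FB FA_GA[OF x(2)] FB_GA[OF x(2)] FA_GB[OF x(3)] FB_GB[OF x(3)]) simp
    then show "x \<in> ?F ` C1"
      using pm.subspace_add[OF subspace_C1 GA_in[OF x(2)] GB_in[OF x(3)]]
      by (rule image_eqI[where f = ?F and x = "?G u v"])
  qed (use FA_in FB_in in \<open>auto simp: direct_sum_rep_def\<close>)
  have GF: "p - ?G (?FA p) (?FB p) \<in> I" if "p \<in> C1" for p
  proof (rule pm_linear_in_subspace[OF _ subspace_I _ that[unfolded C1_def],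
        where f = "\<lambda>p. p - ?G (?FA p) (?FB p)"])
    show "pm_linear (\<lambda>p. p - ?G (?FA p) (?FB p))"
      by (rule pm_linear_minus[OF pm_linear_id pm_linear_plus[OF
            pm_linear_compose[OF linear_deg1_ext linear_tab1_ext]
            pm_linear_compose[OF linear_deg1_ext linear_tab2_ext]]])
    fix r assume "r \<in> ?SC"
    then obtain i j where r: "r = gen i j" and ij: "i \<in> ?X" "j \<in> ?X" by blast
    \<comment> \<open>Writing \<open>gen i j\<close> as an average over \<open>k\<close> merges
      everything into a single sum over \<open>k\<close>, each of whose summands is a combination of
      three antisymmetry relations.\<close>
    have "r - ?G (?FA r) (?FB r) = pm_scale (1 / of_nat n) (\<Sum>k\<in>?X. gen i j)
        - (pm_scale (1 / of_nat n) (\<Sum>k\<in>?X. gen i k - gen j k)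
          + (\<Sum>k\<in>?X. pm_scale (1 / of_nat (2 * n))
              ((gen i j - gen j i) + (gen j k - gen k j) + (gen k i - gen i k))))"
      unfolding r deg1_ext_gen GA_SA lin_GB(4) GB_SB n_scale ..
    also have "\<dots> = (\<Sum>k\<in>?X. pm_scale (1 / of_nat (2 * n))
        ((gen i j + gen j i) - (gen i k + gen k i) + (gen j k + gen k j)))"
      unfolding pm.scale_sum_right sum.distrib[symmetric] sum_subtractf[symmetric]
      by (intro sum.cong refl poly_mapping_eqI) (simp add: lookup_add lookup_minus field_simps)
    also have "\<dots> \<in> I"
      using ij by (intro pm.subspace_sum[OF subspace_I] pm.subspace_scale[OF subspace_I]
          pm.subspace_add[OF subspace_I] pm.subspace_diff[OF subspace_I] gen_in_I(2))
    finally show "r - ?G (?FA r) (?FB r) \<in> I" .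
  qed
  have F_push: "?F (push s p) = (pm_push (tabloid_act s) (?FA p), pm_push (tabloid_act s) (?FB p))"
    if s: "s permutes ?X" and p: "p \<in> C1" for s p
  proof -
    have "?FA (push s p) = pm_push (tabloid_act s) (?FA p)"
    proof (rule pm_linear_eq_on_span[OF _ _ _ p[unfolded C1_def],
          where f = "\<lambda>p. ?FA (push s p)" and g = "\<lambda>p. pm_push (tabloid_act s) (?FA p)"])
      fix r assume "r \<in> ?SC"
      then show "?FA (push s r) = pm_push (tabloid_act s) (?FA r)"
        by (auto simp: push_gen pm_linear_diff[OF linear_pm_push] push_tab1[OF s] simp del: One_nat_def)
    qed (rule pm_linear_compose[OF linear_push linear_deg1_ext]
        pm_linear_compose[OF linear_deg1_ext linear_pm_push])+
    moreover have "?FB (push s p) = pm_push (tabloid_act s) (?FB p)"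
    proof (rule pm_linear_eq_on_span[OF _ _ _ p[unfolded C1_def],
          where f = "\<lambda>p. ?FB (push s p)" and g = "\<lambda>p. pm_push (tabloid_act s) (?FB p)"])
      fix r assume "r \<in> ?SC"
      then obtain i j where r: "r = gen i j" by blast
      \<comment> \<open>The sum runs over all of \<open>?X\<close>, so it may be reindexed by
        \<open>s\<close>; this makes the second component equivariant.\<close>
      have "?hB (s i) (s j) = (\<Sum>k\<in>?X. alt3 ?X (s i) (s j) (s k))"
        by (subst sum.permute[OF s]) (simp add: o_def)
      then show "?FB (push s r) = pm_push (tabloid_act s) (?FB r)"
        unfolding r push_gen deg1_ext_gen pm_linear_sum[OF linear_pm_push] push_alt3[OF s] .
    qed (rule pm_linear_compose[OF linear_push linear_deg1_ext]
        pm_linear_compose[OF linear_deg1_ext linear_pm_push])+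
    ultimately show ?thesis by simp
  qed
  have A_simps: "\<zero>\<^bsub>A\<^esub> = 0" "add A = (+)" "smult A = pm_scale" "act A = (\<lambda>s. pm_push (tabloid_act s))"
    by (simp_all add: A_def)
  have "rep_isomorphic (sym_group_on ?X) (conf_cohomology_rep n d (d - 1) (natural_act n d))
    (direct_sum_rep A B)"
  proof (rule rep_isomorphic_quotientI[OF representation_direct_sum[OF repA repB] subspace_I
        subspace_C1 rep_simps(1,2,3,4) F_image])
    fix p assume p: "p \<in> C1"
    note p' = FA_in[OF p] FB_in[OF p]
    show "?F p = \<zero>\<^bsub>direct_sum_rep A B\<^esub> \<longleftrightarrow> p \<in> I"
    proof
      assume "?F p = \<zero>\<^bsub>direct_sum_rep A B\<^esub>"
      then have F0: "?FA p = 0" "?FB p = 0"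
        by (simp_all only: direct_sum_rep_def ring.simps A_simps B_simps prod.inject)
      show "p \<in> I"
        using GF[OF p] unfolding F0 lin_GA lin_GB by simp
    next
      assume "p \<in> I"
      then show "?F p = \<zero>\<^bsub>direct_sum_rep A B\<^esub>"
        by (simp only: F_I direct_sum_rep_def ring.simps A_simps B_simps)
    qed
    show "?F (pm_scale c p) = c \<odot>\<^bsub>direct_sum_rep A B\<^esub> ?F p" for c
      by (simp only: lin_FA lin_FB direct_sum_rep_def module.simps A_simps B_simps(3)[OF p'(2)] prod.case)
    show "?F (p + q) = ?F p \<oplus>\<^bsub>direct_sum_rep A B\<^esub> ?F q" for q
      by (simp only: lin_FA lin_FB direct_sum_rep_def ring.simps A_simps B_simps prod.case)
    fix s assume "s \<in> carrier (sym_group_on ?X)"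
    then have s: "s permutes ?X" by (simp add: sym_group_on_def)
    have "?F (push s p) = act (direct_sum_rep A B) s (?F p)"
      unfolding F_push[OF s p]
      by (simp only: direct_sum_rep_def rep.simps A_simps B_simps(4)[OF p'(2)] prod.case)
    then show "\<exists>q\<in>C1. act (conf_cohomology_rep n d (d - 1) (natural_act n d)) s (pm_coset I p) = pm_coset I q \<and>
        ?F q = act (direct_sum_rep A B) s (?F p)"
      unfolding rep_simps(5) natural_act_coset[OF s] using push_C1[OF s p] by blast
  qed
  then show ?thesis unfolding G A_def B_def .
qed

end

theorem proposition1:
  fixes n d :: nat
  assumes "odd d" and "d \<ge> 3" and "n \<ge> 2"
  shows "(\<forall>\<rho>. extended_action n d \<rho> \<longrightarrow>
            rep_isomorphic (sym_group_on {0..n}) (conf_cohomology_rep n d (d - 1) \<rho>)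
              (ext_square (specht {0..n} [n, 1])))
       \<and> rep_isomorphic (sym_group_on {0..n}) (ext_square (specht {0..n} [n, 1]))
            (specht {0..n} [n - 1, 1, 1])
       \<and> rep_isomorphic (sym_group n) (conf_cohomology_rep n d (d - 1) (natural_act n d))
            (direct_sum_rep (specht {1..n} [n - 1, 1])
              (if n = 2 then zero_rep else specht {1..n} [n - 2, 1, 1]))"
proof -
  interpret conf n d by unfold_locales (fact assms)+
  interpret S: pointed_set "{0..n}" "n - 1" 0
    by unfold_locales (use assms in auto)
  have ext: "rep_isomorphic (sym_group_on {0..n}) (ext_square (specht {0..n} [n, 1]))
      (specht {0..n} [n - 1, 1, 1])"
    \<comment> \<open>The locale supplies the shape \<open>[n - 1 + 1, 1]\<close>; it equals
      \<open>[n, 1]\<close> because \<open>n\<close> is positive.\<close>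
    using S.ext_square_isomorphic n unfolding S.V_def S.W_def by simp
  show ?thesis
    using ext natural_isomorphic rep_isomorphic_trans[OF extended_isomorphic rep_isomorphic_sym[OF ext]]
    by blast
qed

end
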